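(* Let $n\ge 2$ be an integer, let $m>0$ and $M\ge 0$ be real numbers, and let $\lambda_n=\frac14\sum_{k=1}^{n-1}\csc(k\pi/n)$. Assume that $\lambda_n\neq n p^2+\frac{M}{m}(p^2-1)$ for every positive integer $p$. Then for every real number $r_0>0$ there exist $b\neq 0$ near $0$, $T>0$ near $\pi\sqrt{\frac{r_0^3}{nm+M}}$, and $a>0$ near $\sqrt{\frac{\lambda_n m+M}{r_0}}$ (that is, for every $\varepsilon>0$ there exist real numbers $a,b,T$ with $a>0$, $T>0$, $0<|b|<\varepsilon$, $\left|T-\pi\sqrt{\frac{r_0^3}{nm+M}}\right|<\varepsilon$ and $\left|a-\sqrt{\frac{\lambda_n m+M}{r_0}}\right|<\varepsilon$) such that the solution $(f,r)$ of the reduced $(n+1)$-body problem with parameters $n,m,M,r_0,a$ and initial conditions $$f(0)=0,\quad \dot f(0)=b,\quad r(0)=r_0,\quad \dot r(0)=0$$ is an odd $2T$-periodic solution.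
   Context: For an integer $n\ge2$, masses $m>0$, $M\ge0$, and real numbers $r_0>0$, $a\neq 0$, the reduced $(n+1)$-body problem is the following system of ordinary differential equations for real functions $f(t)$ and $r(t)>0$: $$\ddot f=-\frac{(M+mn)f}{h^3},\qquad \ddot r=\frac{r_0^2a^2}{r^3}-\frac{m\lambda_n}{r^2}-\frac{Mr}{h^3},\qquad h=\sqrt{r^2+\Big(\frac{M+nm}{mn}\Big)^2f^2},$$ where $\lambda_n=\frac14\sum_{k=1}^{n-1}\csc(k\pi/n)$. (It describes $n$ bodies of mass $m$ at the vertices of a regular polygon of radius $r$ perpendicular to the $z$-axis, and a body of mass $M$ at height $f$ on the $z$-axis; $r_0a$ is the nonzero angular momentum constant.) A solution $(f,r)$ with $f(0)=0$, $\dot f(0)=b$, $r(0)=r_0$, $\dot r(0)=0$ is called an odd $2T$-periodic solution ($T>0$) if it satisfies $f(T)=0$ and $\dot r(T)=0$, and $f$ and $r$ are both $2T$-periodic functions; in this case $f$ is an odd function and $r$ is an even function of $t$. *)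

theory Defs
  imports "HOL-Analysis.Analysis"
begin

definition lam :: "nat \<Rightarrow> real" where
  "lam n = (1 / 4) * (\<Sum>k = 1..n - 1. 1 / sin (real k * pi / real n))"

text \<open>The distance between a polygon vertex and the body of mass \<open>M\<close> on the axis.\<close>

definition hdist :: "nat \<Rightarrow> real \<Rightarrow> real \<Rightarrow> real \<Rightarrow> real \<Rightarrow> real" where
  "hdist n m M f r = sqrt (r\<^sup>2 + ((M + real n * m) / (m * real n))\<^sup>2 * f\<^sup>2)"

text \<open>
  Solutions are understood on the whole real line. The function \<^const>\<open>deriv\<close> is meaningless where
  its argument is not differentiable, hence the separate clauses on the first derivatives.
\<close>

definition reduced_solution ::
  "nat \<Rightarrow> real \<Rightarrow> real \<Rightarrow> real \<Rightarrow> real \<Rightarrow> (real \<Rightarrow> real) \<Rightarrow> (real \<Rightarrow> real) \<Rightarrow> bool" where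
  "reduced_solution n m M r0 a f r \<longleftrightarrow>
    (\<forall>t. r t > 0 \<and>
      (f has_real_derivative deriv f t) (at t) \<and>
      (r has_real_derivative deriv r t) (at t) \<and>
      (deriv f has_real_derivative
        - ((M + m * real n) * f t) / (hdist n m M (f t) (r t)) ^ 3) (at t) \<and>
      (deriv r has_real_derivative
        r0\<^sup>2 * a\<^sup>2 / (r t) ^ 3 - m * lam n / (r t)\<^sup>2
          - M * r t / (hdist n m M (f t) (r t)) ^ 3) (at t))"

definition reduced_ivp_solution ::
  "nat \<Rightarrow> real \<Rightarrow> real \<Rightarrow> real \<Rightarrow> real \<Rightarrow> real \<Rightarrow> (real \<Rightarrow> real) \<Rightarrow> (real \<Rightarrow> real) \<Rightarrow> bool" where
  "reduced_ivp_solution n m M r0 a b f r \<longleftrightarrow>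
    reduced_solution n m M r0 a f r \<and>
    f 0 = 0 \<and> deriv f 0 = b \<and> r 0 = r0 \<and> deriv r 0 = 0"

text \<open>
  Oddness of \<open>f\<close> and evenness of \<open>r\<close> are consequences of the initial conditions and of
  uniqueness for the initial value problem; they are not part of the definition.
\<close>

definition odd_periodic_solution ::
  "nat \<Rightarrow> real \<Rightarrow> real \<Rightarrow> real \<Rightarrow> real \<Rightarrow> real \<Rightarrow> real \<Rightarrow> (real \<Rightarrow> real) \<Rightarrow> (real \<Rightarrow> real) \<Rightarrow> bool" where
  "odd_periodic_solution n m M r0 a b T f r \<longleftrightarrow>
    reduced_ivp_solution n m M r0 a b f r \<and> T > 0 \<and>
    f T = 0 \<and> deriv r T = 0 \<and>
    (\<forall>t. f (t + 2 * T) = f t) \<and> (\<forall>t. r (t + 2 * T) = r t)"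

end

theory Submission
  imports Defs
begin

text \<open>
The circle \<open>f = 0\<close>, \<open>r = r0\<close>, \<open>a\<^sup>2 = p0 = (\<lambda> m + M) / r0\<close>, where \<open>\<lambda> = lam n\<close>, is an
equilibrium of the system, and the periodic orbits bifurcate from it. Write the system as a
first-order autonomous equation for the state \<open>(f, f', r, r', p)\<close> with the constant \<open>p = a\<^sup>2\<close> as
a fifth coordinate. Varying \<open>a\<close> then amounts to varying the initial state, and
\<open>f' 0 = \<delta>\<close>, \<open>a\<^sup>2 = p0 + \<delta> \<alpha>\<close> is a displacement of size \<open>\<delta>\<close> from the equilibrium.

At the equilibrium the linearized system decouples into two oscillators, \<open>f'' = - \<omega>1\<^sup>2 f\<close> with
\<open>\<omega>1\<^sup>2 = (n m + M) / r0\<^sup>3\<close>, and \<open>r'' = \<alpha> / r0 - \<omega>2\<^sup>2 r\<close> with \<open>\<omega>2\<^sup>2 = (\<lambda> m + M) / r0\<^sup>3\<close>. Gronwall's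
inequality gives, uniformly for \<open>\<bar>\<alpha>\<bar> \<le> 1\<close> and \<open>T\<close> in a compact interval, as \<open>\<delta>\<close> tends to \<open>0\<close>,
\<open>f T / \<delta> \<longlongrightarrow> sin (\<omega>1 T) / \<omega>1\<close> and \<open>r' T / \<delta> \<longlongrightarrow> \<alpha> sin (\<omega>2 T) / (r0 \<omega>2)\<close>.
The first limit changes sign at \<open>T0 = \<pi> / \<omega>1\<close>. The second changes sign with \<open>\<alpha>\<close> as soon as
\<open>sin (\<omega>2 T0) \<noteq> 0\<close>, which says that \<open>\<omega>2 / \<omega>1\<close> is not an integer: this is the assumption on \<open>\<lambda>\<close>
(\<open>nonresonance\<close>). For small \<open>\<delta>\<close> the signs persist on the boundary of a small rectangle in the
\<open>(\<alpha>, T)\<close>-plane, and the Poincare-Miranda theorem, a form of Brouwer's fixed point theorem,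
yields a common zero of \<open>f T\<close> and \<open>r' T\<close> (\<open>periodic_orbit_near_circle\<close>). What this takes is
the derivative of the field at the equilibrium and continuity of the flow in its initial state.

The system is invariant under \<open>t \<mapsto> - t\<close>, \<open>(f, r) \<mapsto> (- f, r)\<close>. An orbit that is fixed by this
reversal at the times \<open>0\<close> and \<open>T\<close> is \<open>2 T\<close>-periodic
(\<open>reversible_arc_gives_periodic_solution\<close>).

The field is singular at \<open>r = 0\<close>, so its flow need not be global. Clipping \<open>f\<close>, \<open>r\<close> and \<open>p\<close> to
compact intervals, with \<open>r\<close> kept away from \<open>0\<close>, makes it globally Lipschitz without breaking the
reversal, and then the solution exists on the whole line by the contraction principle. The
orbits used here stay in the region where nothing is clipped, so they solve the original
system. The same clipping, with bounds that depend on the time interval, gives uniqueness for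
the original system (\<open>reduced_ivp_solution_unique\<close>), which carries the result over from the
constructed orbit to every solution with the same initial data.
\<close>

section \<open>Globally Lipschitz autonomous equations\<close>

lemma has_vector_derivative_reflect:
  fixes x :: "real \<Rightarrow> 'a::real_normed_vector"
  assumes "(x has_vector_derivative v) (at (c - t))"
  shows "((\<lambda>t. x (c - t)) has_vector_derivative - v) (at t)"
proof -
  have "((\<lambda>t. c - t) has_vector_derivative -1) (at t)"
    by (auto intro!: derivative_eq_intros)
  from vector_diff_chain_at[OF this assms] show ?thesis by (simp add: o_def)
qed

text \<open>
This is the estimate that makes the Picard operator a contraction for the weight
\<open>exp (K \<bar>t\<bar>)\<close>: integrating a function of that growth gains a factor \<open>1 / K\<close>. For \<open>t > 0\<close> compare
derivatives; negative times follow by reflection.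
\<close>

lemma exp_weighted_antiderivative_bound:
  fixes P :: "real \<Rightarrow> 'a::real_normed_vector"
  assumes P: "\<And>t. (P has_vector_derivative p t) (at t)" and "P 0 = 0" and "K > 0"
    and bnd: "\<And>t. norm (p t) \<le> C * exp (K * \<bar>t\<bar>)"
  shows "norm (P t) \<le> C / K * exp (K * \<bar>t\<bar>)"
proof -
  have "0 \<le> norm (p 0)" by simp
  also have "\<dots> \<le> C" using bnd[of 0] by simp
  finally have "C \<ge> 0" .
  have pos: "norm (Q s) \<le> C / K * exp (K * s)"
    if Q: "\<And>t. (Q has_vector_derivative q t) (at t)" and "Q 0 = 0"
      and q: "\<And>t. norm (q t) \<le> C * exp (K * \<bar>t\<bar>)" and "s > 0"
    for Q q :: "real \<Rightarrow> 'a" and s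
  proof -
    have "norm (Q s - Q 0) \<le> C / K * exp (K * s) - C / K * exp (K * 0)"
    proof (rule differentiable_bound_general[OF \<open>s > 0\<close>])
      show "continuous_on {0..s} Q"
        using Q by (meson continuous_at_imp_continuous_on has_vector_derivative_continuous)
      show "((\<lambda>t. C / K * exp (K * t)) has_vector_derivative C * exp (K * t)) (at t)" for t
        using \<open>K > 0\<close>
        by (auto intro!: derivative_eq_intros simp flip: has_real_derivative_iff_has_vector_derivative)
      show "norm (q t) \<le> C * exp (K * t)" if "0 < t" for t
        using q[of t] that by simp
    qed (use Q \<open>K > 0\<close> in \<open>auto intro!: continuous_intros\<close>)
    also have "\<dots> \<le> C / K * exp (K * s)" using \<open>C \<ge> 0\<close> \<open>K > 0\<close> by simp
    finally show ?thesis using \<open>Q 0 = 0\<close> by simp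
  qed
  have "((\<lambda>s. P (- s)) has_vector_derivative - p (- s)) (at s)" for s
    using has_vector_derivative_reflect[where c = 0, simplified] P by blast
  then have "norm (P (- s)) \<le> C / K * exp (K * s)" if "s > 0" for s
    using pos[of "\<lambda>s. P (- s)" "\<lambda>s. - p (- s)" s] bnd[of "- x" for x] that \<open>P 0 = 0\<close> by simp
  from this[of "- t"] pos[OF P \<open>P 0 = 0\<close> bnd, of t] \<open>P 0 = 0\<close> \<open>C \<ge> 0\<close> \<open>K > 0\<close>
  show ?thesis by (cases t "0::real" rule: linorder_cases) auto
qed

lemma continuous_antiderivative_real_line:
  fixes g :: "real \<Rightarrow> 'a::euclidean_space"
  assumes "continuous_on UNIV g"
  obtains G where "G 0 = 0" "\<And>t. (G has_vector_derivative g t) (at t)"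
proof -
  obtain H where H: "(H has_vector_derivative g t) (at t)" for t
    using einterval_antiderivative[of "- \<infinity>" \<infinity> g] assms
    by (auto simp: continuous_on_eq_continuous_at)
  show thesis
    by (rule that[of "\<lambda>t. H t - H 0"]) (use H in \<open>auto intro!: derivative_eq_intros\<close>)
qed

text \<open>
Picard iteration on the whole line at once. Write the unknown as \<open>exp (K \<bar>t\<bar>)\<close> times a bounded
continuous function \<open>y\<close>. With \<open>K = 2 L + 1\<close> the integral operator on \<open>y\<close> contracts distances
by \<open>L / K \<le> 1 / 2\<close>, so Banach's theorem gives a fixed point.
\<close>

proposition lipschitz_ode_global_solution:
  fixes F :: "'a::euclidean_space \<Rightarrow> 'a"
  assumes F: "L-lipschitz_on UNIV F"
  obtains x where "x 0 = x0" "\<And>t. (x has_vector_derivative F (x t)) (at t)"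
proof -
  define K where "K = 2 * L + 1"
  have L: "L \<ge> 0" using F by (rule lipschitz_on_nonneg)
  have K: "K > 0" using L by (simp add: K_def)
  define w where "w t = exp (K * \<bar>t\<bar>)" for t :: real
  have w: "w t \<ge> 1" "w t > 0" for t using K by (auto simp: w_def)
  have contw: "continuous_on UNIV w" unfolding w_def by (intro continuous_intros)
  have contF: "continuous_on UNIV F" using F by (rule lipschitz_on_continuous_on)
  define z where "z y t = w t *\<^sub>R apply_bcontfun y t" for y :: "real \<Rightarrow>\<^sub>C 'a" and t
  have contz: "continuous_on UNIV (\<lambda>t. F (z y t))" for y
    unfolding z_def
    by (intro continuous_on_compose2[OF contF] continuous_intros contw) auto
  have "\<exists>P. P 0 = 0 \<and> (\<forall>t. (P has_vector_derivative F (z y t)) (at t))" for y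
    by (rule continuous_antiderivative_real_line[OF contz]) blast
  then obtain P where P0: "P y 0 = 0"
    and P: "(P y has_vector_derivative F (z y t)) (at t)" for y t
    by metis
  define V where "V y t = (1 / w t) *\<^sub>R (x0 + P y t)" for y t
  have V_bcontfun: "V y \<in> bcontfun" for y
  proof -
    obtain B where B: "norm (apply_bcontfun y t) \<le> B" for t
      using bounded_apply_bcontfun[of y] by (auto simp: bounded_iff)
    have "norm (F (z y t)) \<le> (norm (F 0) + L * B) * exp (K * \<bar>t\<bar>)" for t
    proof -
      have "norm (F (z y t)) \<le> norm (F 0) + norm (F (z y t) - F 0)"
        by (metis add.commute diff_add_cancel norm_triangle_ineq)
      also have "\<dots> \<le> norm (F 0) + L * norm (z y t)"
        using lipschitz_on_normD[OF F, of "z y t" 0] by simp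
      also have "\<dots> \<le> norm (F 0) + L * (w t * B)"
        using B[of t] w[of t] L by (intro add_left_mono mult_left_mono) (simp_all add: z_def)
      also have "\<dots> \<le> norm (F 0) * w t + L * (w t * B)"
        using w(1)[of t] by (simp add: mult_le_cancel_left1)
      finally show ?thesis by (simp add: w_def algebra_simps)
    qed
    from exp_weighted_antiderivative_bound[OF P P0 K this]
    have Pb: "norm (P y t) \<le> (norm (F 0) + L * B) / K * w t" for t by (simp add: w_def)
    have "norm (V y t) \<le> norm x0 + (norm (F 0) + L * B) / K" for t
    proof -
      have "norm (x0 + P y t) \<le> norm x0 * w t + (norm (F 0) + L * B) / K * w t"
        using norm_triangle_ineq[of x0 "P y t"] Pb[of t] w(1)[of t]
        by (smt (verit) mult_le_cancel_left1 norm_ge_zero)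
      then show ?thesis
        using w[of t] by (simp add: V_def divide_le_eq distrib_right)
    qed
    moreover have "continuous_on UNIV (V y)"
      unfolding V_def
    proof (intro continuous_intros contw)
      show "continuous_on UNIV (P y)"
        using P by (meson continuous_at_imp_continuous_on has_vector_derivative_continuous)
      show "\<forall>x\<in>UNIV. w x \<noteq> 0" using w by (metis less_irrefl)
    qed
    ultimately show ?thesis by (intro bcontfun_normI) auto
  qed
  have contraction: "dist (Bcontfun (V y1)) (Bcontfun (V y2)) \<le> 1 / 2 * dist y1 y2" for y1 y2
  proof (rule dist_bound)
    fix t
    have "norm (P y1 t - P y2 t) \<le> L * dist y1 y2 / K * exp (K * \<bar>t\<bar>)"
    proof (rule exp_weighted_antiderivative_bound[OF _ _ K])
      show "((\<lambda>t. P y1 t - P y2 t) has_vector_derivative F (z y1 t) - F (z y2 t)) (at t)" for t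
        using P by (intro derivative_intros)
      show "norm (F (z y1 t) - F (z y2 t)) \<le> L * dist y1 y2 * exp (K * \<bar>t\<bar>)" for t
      proof -
        have "norm (F (z y1 t) - F (z y2 t)) \<le> L * norm (z y1 t - z y2 t)"
          using lipschitz_on_normD[OF F] by simp
        also have "norm (z y1 t - z y2 t) = w t * dist (y1 t) (y2 t)"
          using w[of t] by (simp add: z_def dist_norm flip: scaleR_diff_right)
        also have "L * (w t * dist (y1 t) (y2 t)) \<le> L * (w t * dist y1 y2)"
          using w[of t] L dist_bounded[of y1 t y2] by (intro mult_left_mono) auto
        finally show ?thesis by (simp add: w_def mult_ac)
      qed
    qed (simp add: P0)
    then have "dist (V y1 t) (V y2 t) \<le> L / K * dist y1 y2"
      using w[of t]
      by (simp add: V_def dist_norm divide_le_eq flip: scaleR_diff_right) (simp add: w_def mult_ac)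
    also have "\<dots> \<le> 1 / 2 * dist y1 y2"
      using L by (intro mult_right_mono) (auto simp: K_def field_simps)
    finally show "dist (apply_bcontfun (Bcontfun (V y1)) t) (apply_bcontfun (Bcontfun (V y2)) t)
        \<le> 1 / 2 * dist y1 y2"
      by (simp add: Bcontfun_inverse V_bcontfun)
  qed
  obtain y where y: "Bcontfun (V y) = y"
    using banach_fix_type[of "1/2" "\<lambda>y. Bcontfun (V y)"] contraction by auto
  have "z y t = x0 + P y t" for t
  proof -
    have "apply_bcontfun y t = V y t"
      by (metis y Bcontfun_inverse V_bcontfun)
    then show ?thesis using w(2)[of t] by (simp add: z_def V_def)
  qed
  then have "z y = (\<lambda>t. x0 + P y t)" by auto
  moreover have "((\<lambda>t. x0 + P y t) has_vector_derivative F (z y t)) (at t)" for t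
    using P by (auto intro!: derivative_eq_intros)
  ultimately show thesis
    by (intro that[of "z y"]) (auto simp: P0)
qed

text \<open>
Gronwall's inequality for a solution \<open>x\<close> and an approximate solution \<open>y\<close>. Squared norms are used
because they are differentiable: \<open>u = \<bar>x - y\<bar>\<^sup>2\<close> satisfies \<open>u' \<le> (2 L + 1) u + e\<^sup>2\<close>, so that
\<open>exp (- (2 L + 1) t) u t - e\<^sup>2 t\<close> is nonincreasing. Uniqueness, continuity in the initial state,
and linearization are all instances.
\<close>

proposition gronwall_defect:
  fixes x y :: "real \<Rightarrow> 'a::real_inner"
  assumes F: "L-lipschitz_on UNIV F"
    and x: "\<And>t. t \<in> {0..T} \<Longrightarrow> (x has_vector_derivative F (x t)) (at t)"
    and y: "\<And>t. t \<in> {0..T} \<Longrightarrow> (y has_vector_derivative y' t) (at t)"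
    and defect: "\<And>t. t \<in> {0..T} \<Longrightarrow> norm (y' t - F (y t)) \<le> e"
    and t: "t \<in> {0..T}"
  shows "(norm (x t - y t))\<^sup>2 \<le> exp ((2 * L + 1) * t) * ((norm (x 0 - y 0))\<^sup>2 + e\<^sup>2 * t)"
proof -
  define c where "c = 2 * L + 1"
  have L: "L \<ge> 0" using F by (rule lipschitz_on_nonneg)
  define u where "u s = (x s - y s) \<bullet> (x s - y s)" for s
  define u' where "u' s = 2 * ((x s - y s) \<bullet> (F (x s) - y' s))" for s
  have u: "(u has_real_derivative u' s) (at s)" if "s \<in> {0..T}" for s
    using bounded_bilinear.has_vector_derivative[OF bounded_bilinear_inner
        has_vector_derivative_diff[OF x[OF that] y[OF that]]
        has_vector_derivative_diff[OF x[OF that] y[OF that]]]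
    unfolding u_def u'_def has_real_derivative_iff_has_vector_derivative
    by (simp add: inner_commute)
  have u'_le: "u' s \<le> c * u s + e\<^sup>2" if "s \<in> {0..T}" for s
  proof -
    define d where "d = norm (x s - y s)"
    have "norm (F (x s) - y' s) \<le> norm (F (x s) - F (y s)) + norm (y' s - F (y s))"
      by (metis norm_minus_commute norm_triangle_sub norm_diff_triangle_le order_refl)
    also have "\<dots> \<le> L * d + e"
      using defect[OF that] lipschitz_on_normD[OF F] by (auto simp: d_def intro: add_mono)
    finally have "u' s \<le> 2 * (d * (L * d + e))"
      using norm_cauchy_schwarz[of "x s - y s" "F (x s) - y' s"]
        mult_left_mono[of "norm (F (x s) - y' s)" "L * d + e" d]
      by (simp add: u'_def d_def)
    also have "\<dots> \<le> 2 * L * d\<^sup>2 + (d\<^sup>2 + e\<^sup>2)"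
      using sum_squares_bound[of d e] by (simp add: algebra_simps power2_eq_square)
    also have "\<dots> = c * u s + e\<^sup>2"
      by (simp add: c_def u_def d_def power2_norm_eq_inner algebra_simps)
    finally show ?thesis .
  qed
  define \<phi> where "\<phi> s = exp (- c * s) * u s - e\<^sup>2 * s" for s
  have "\<phi> 0 \<ge> \<phi> t"
  proof (rule DERIV_nonpos_imp_nonincreasing[of 0 t \<phi>])
    fix s assume "0 \<le> s" "s \<le> t"
    then have s: "s \<in> {0..T}" using t by auto
    have "(\<phi> has_real_derivative exp (- c * s) * (u' s - c * u s) - e\<^sup>2) (at s)"
      unfolding \<phi>_def by (auto intro!: derivative_eq_intros u[OF s] simp: algebra_simps)
    moreover have "exp (- c * s) * (u' s - c * u s) \<le> 1 * e\<^sup>2"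
    proof -
      have "exp (- c * s) * (u' s - c * u s) \<le> exp (- c * s) * e\<^sup>2"
        using u'_le[OF s] by (intro mult_left_mono) auto
      also have "\<dots> \<le> 1 * e\<^sup>2"
        using \<open>0 \<le> s\<close> L by (intro mult_right_mono) (auto simp: c_def mult_nonpos_nonneg)
      finally show ?thesis .
    qed
    ultimately show "\<exists>d. (\<phi> has_real_derivative d) (at s) \<and> d \<le> 0"
      by (intro exI[of _ "exp (- c * s) * (u' s - c * u s) - e\<^sup>2"]) auto
  qed (use t in auto)
  then have "exp (- c * t) * u t \<le> u 0 + e\<^sup>2 * t"
    by (simp add: \<phi>_def)
  then have "u t \<le> exp (c * t) * (u 0 + e\<^sup>2 * t)"
    by (simp add: exp_minus field_simps)
  then show ?thesis by (simp add: u_def c_def power2_norm_eq_inner)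
qed

lemma lipschitz_ode_unique_nonneg:
  fixes x y :: "real \<Rightarrow> 'a::real_inner"
  assumes "L-lipschitz_on UNIV F"
    and "\<And>t. t \<in> {0..T} \<Longrightarrow> (x has_vector_derivative F (x t)) (at t)"
    and "\<And>t. t \<in> {0..T} \<Longrightarrow> (y has_vector_derivative F (y t)) (at t)"
    and "x 0 = y 0" and "t \<in> {0..T}"
  shows "x t = y t"
proof -
  have "(norm (x t - y t))\<^sup>2 \<le> exp ((2 * L + 1) * t) * ((norm (x 0 - y 0))\<^sup>2 + 0\<^sup>2 * t)"
    by (rule gronwall_defect[OF assms(1-3) _ assms(5)]) auto
  then show ?thesis using \<open>x 0 = y 0\<close> by simp
qed

proposition lipschitz_ode_unique:
  fixes x y :: "real \<Rightarrow> 'a::real_inner"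
  assumes F: "L-lipschitz_on UNIV F"
    and x: "\<And>t. \<bar>t\<bar> \<le> T \<Longrightarrow> (x has_vector_derivative F (x t)) (at t)"
    and y: "\<And>t. \<bar>t\<bar> \<le> T \<Longrightarrow> (y has_vector_derivative F (y t)) (at t)"
    and "x 0 = y 0" and t: "\<bar>t\<bar> \<le> T"
  shows "x t = y t"
proof (cases "t \<ge> 0")
  case True
  show ?thesis
    by (rule lipschitz_ode_unique_nonneg[OF F, of T]) (use x y t True \<open>x 0 = y 0\<close> in auto)
next
  case False
  have F': "L-lipschitz_on UNIV (\<lambda>x. - F x)" using F by simp
  have "x (0 - (- t)) = y (0 - (- t))"
    by (rule lipschitz_ode_unique_nonneg[OF F', of T "\<lambda>t. x (0 - t)" "\<lambda>t. y (0 - t)" "- t"])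
      (use x y t False \<open>x 0 = y 0\<close> in
        \<open>auto intro!: has_vector_derivative_reflect[where c = 0, simplified]\<close>)
  then show ?thesis by simp
qed

text \<open>
Gronwall's inequality bounds the effect of the initial state locally uniformly in time, and each
single orbit is continuous in time.
\<close>

lemma lipschitz_flow_jointly_continuous:
  fixes \<Phi> :: "'a::real_inner \<Rightarrow> real \<Rightarrow> 'a"
  assumes F: "L-lipschitz_on UNIV F"
    and init: "\<And>p. \<Phi> p 0 = p"
    and sol: "\<And>p t. (\<Phi> p has_vector_derivative F (\<Phi> p t)) (at t)"
  shows "continuous_on (UNIV \<times> {0..}) (\<lambda>(p, t). \<Phi> p t)"
proof -
  define c where "c = 2 * L + 1"
  have cont: "isCont (\<Phi> q) s" for q s
    using sol by (rule has_vector_derivative_continuous)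
  have "((\<lambda>z. \<Phi> (fst z) (snd z)) \<longlongrightarrow> \<Phi> q s) (at (q, s) within UNIV \<times> {0..})" for q s
  proof -
    define g where
      "g z = sqrt (exp (c * snd z)) * norm (fst z - q) + norm (\<Phi> q (snd z) - \<Phi> q s)" for z
    have "norm (\<Phi> p t - \<Phi> q s) \<le> g (p, t)" if "t \<ge> 0" for p t
    proof -
      have "(norm (\<Phi> p t - \<Phi> q t))\<^sup>2 \<le> exp (c * t) * (norm (p - q))\<^sup>2"
        using gronwall_defect[of L F t "\<Phi> p" "\<Phi> q" "\<lambda>t. F (\<Phi> q t)" 0 t] F sol that
        by (simp add: init c_def)
      from real_sqrt_le_mono[OF this]
      have "norm (\<Phi> p t - \<Phi> q t) \<le> sqrt (exp (c * t)) * norm (p - q)"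
        by (simp add: real_sqrt_mult)
      then show ?thesis
        unfolding g_def fst_conv snd_conv
        by (smt (verit) norm_diff_triangle_le order_refl)
    qed
    then have "\<forall>\<^sub>F z in at (q, s) within UNIV \<times> {0..}.
        norm (\<Phi> (fst z) (snd z) - \<Phi> q s) \<le> g z"
      by (auto simp: eventually_at_filter intro!: always_eventually)
    moreover have "(g \<longlongrightarrow> g (q, s)) (at (q, s) within UNIV \<times> {0..})"
      unfolding g_def
      by (intro tendsto_intros isCont_tendsto_compose[OF cont])
    then have "(g \<longlongrightarrow> 0) (at (q, s) within UNIV \<times> {0..})"
      by (simp add: g_def)
    ultimately show ?thesis
      by (rule LIM_zero_cancel[OF Lim_null_comparison])
  qed
  then show ?thesis
    by (auto simp: continuous_on_def case_prod_unfold)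
qed

text \<open>
If \<open>y\<close> solves the linearized equation, then \<open>p + \<delta> y\<close> solves the full equation up to a defect that
is \<open>o(\<delta>)\<close>, by differentiability at \<open>p\<close> alone, and Gronwall's inequality turns the small defect into
a small error. The bound \<open>d\<close> on \<open>\<delta>\<close> depends on \<open>y\<close> only through \<open>K\<close>, which gives uniformity over a
family of initial directions.
\<close>

proposition flow_linearization_at_equilibrium:
  fixes F A :: "'a::real_inner \<Rightarrow> 'a"
  assumes F: "L-lipschitz_on UNIV F"
    and "F p = 0" and dF: "(F has_derivative A) (at p)"
    and "T \<ge> 0" "K > 0" "e > 0"
  obtains d where "d > 0"
    "\<And>\<delta> x y t. \<lbrakk>0 < \<delta>; \<delta> < d;
        \<And>t. t \<in> {0..T} \<Longrightarrow> (x has_vector_derivative F (x t)) (at t);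
        \<And>t. t \<in> {0..T} \<Longrightarrow> (y has_vector_derivative A (y t)) (at t);
        \<And>t. t \<in> {0..T} \<Longrightarrow> norm (y t) \<le> K;
        x 0 = p + \<delta> *\<^sub>R y 0; t \<in> {0..T}\<rbrakk>
      \<Longrightarrow> norm (x t - (p + \<delta> *\<^sub>R y t)) \<le> \<delta> * e"
proof -
  have L: "L \<ge> 0" using F by (rule lipschitz_on_nonneg)
  define c where "c = exp ((2 * L + 1) * T) * T"
  have c: "c \<ge> 0" using \<open>T \<ge> 0\<close> by (simp add: c_def)
  \<comment> \<open>The relative accuracy of the linear approximation for which the Gronwall factor \<open>c\<close> still
    leaves an error of at most \<open>e\<close>.\<close>
  define \<eta> where "\<eta> = e / (K * (sqrt c + 1))"
  have "sqrt c + 1 > 0" using c by (simp add: add_nonneg_pos)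
  then have "\<eta> > 0" using \<open>e > 0\<close> \<open>K > 0\<close> by (simp add: \<eta>_def)
  have "sqrt c * (\<eta> * K) \<le> e"
    using \<open>K > 0\<close> \<open>sqrt c + 1 > 0\<close> \<open>e > 0\<close> by (simp add: \<eta>_def divide_le_eq)
  then have "(sqrt c * (\<eta> * K))\<^sup>2 \<le> e\<^sup>2"
    using c \<open>\<eta> > 0\<close> \<open>K > 0\<close> by (intro power_mono) auto
  then have budget: "c * (\<eta> * K)\<^sup>2 \<le> e\<^sup>2"
    using c by (simp add: power_mult_distrib)
  obtain d0 where "d0 > 0"
    and d0: "\<And>q. norm (q - p) < d0 \<Longrightarrow> norm (F q - F p - A (q - p)) \<le> \<eta> * norm (q - p)"
    using dF \<open>\<eta> > 0\<close> unfolding has_derivative_at_alt by blast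
  have A: "bounded_linear A" using dF by (rule has_derivative_bounded_linear)
  show thesis
  proof (rule that[of "d0 / K"])
    show "d0 / K > 0" using \<open>d0 > 0\<close> \<open>K > 0\<close> by simp
    fix \<delta> x y t
    assume \<delta>: "0 < \<delta>" "\<delta> < d0 / K"
      and x: "\<And>t. t \<in> {0..T} \<Longrightarrow> (x has_vector_derivative F (x t)) (at t)"
      and y: "\<And>t. t \<in> {0..T} \<Longrightarrow> (y has_vector_derivative A (y t)) (at t)"
      and yK: "\<And>t. t \<in> {0..T} \<Longrightarrow> norm (y t) \<le> K"
      and x0: "x 0 = p + \<delta> *\<^sub>R y 0" and t: "t \<in> {0..T}"
    have defect: "norm (\<delta> *\<^sub>R A (y s) - F (p + \<delta> *\<^sub>R y s)) \<le> \<delta> * (\<eta> * K)" if s: "s \<in> {0..T}" for s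
    proof -
      have ys: "norm (\<delta> *\<^sub>R y s) \<le> \<delta> * K" using yK[OF s] \<delta> by simp
      also have "\<dots> < d0" using \<delta> \<open>K > 0\<close> by (simp add: less_divide_eq)
      finally have "norm (F (p + \<delta> *\<^sub>R y s) - \<delta> *\<^sub>R A (y s)) \<le> \<eta> * norm (\<delta> *\<^sub>R y s)"
        using d0[of "p + \<delta> *\<^sub>R y s"] \<open>F p = 0\<close>
          linear_cmul[OF bounded_linear.linear[OF A]] by simp
      also have "\<dots> \<le> \<eta> * (\<delta> * K)" using ys \<open>\<eta> > 0\<close> by (intro mult_left_mono) auto
      finally show ?thesis by (simp add: norm_minus_commute mult_ac)
    qed
    have "((\<lambda>t. p + \<delta> *\<^sub>R y t) has_vector_derivative \<delta> *\<^sub>R A (y s)) (at s)" if "s \<in> {0..T}" for s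
      using y[OF that] by (auto intro!: derivative_eq_intros)
    from gronwall_defect[OF F x this defect t]
    have "(norm (x t - (p + \<delta> *\<^sub>R y t)))\<^sup>2 \<le> exp ((2 * L + 1) * t) * (t * (\<delta> * (\<eta> * K))\<^sup>2)"
      by (simp add: x0 mult_ac)
    also have "\<dots> \<le> exp ((2 * L + 1) * T) * (T * (\<delta> * (\<eta> * K))\<^sup>2)"
      using t L by (intro mult_mono mult_right_mono) (auto intro: mult_left_mono)
    also have "\<dots> = \<delta>\<^sup>2 * (c * (\<eta> * K)\<^sup>2)" by (simp add: c_def power_mult_distrib mult_ac)
    also have "\<dots> \<le> (\<delta> * e)\<^sup>2"
      using budget by (simp add: power_mult_distrib mult_left_mono)
    finally show "norm (x t - (p + \<delta> *\<^sub>R y t)) \<le> \<delta> * e"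
      by (rule power2_le_imp_le) (use \<delta> \<open>e > 0\<close> in simp)
  qed
qed

section \<open>Time-reversible equations\<close>

text \<open>
If the reversal \<open>S\<close> maps the field to its negative, then \<open>S (x (c - t))\<close> is again a solution. When
\<open>x c\<close> is fixed by \<open>S\<close> it has the same value at \<open>t = 0\<close> as \<open>x (c + t)\<close>, and uniqueness identifies the
two.
\<close>

lemma reversible_orbit_symmetric:
  fixes F S :: "'a::real_inner \<Rightarrow> 'a"
  assumes F: "L-lipschitz_on UNIV F" and S: "bounded_linear S"
    and rev: "\<And>z. F (S z) = - S (F z)"
    and x: "\<And>t. (x has_vector_derivative F (x t)) (at t)"
    and "S (x c) = x c"
  shows "S (x (c - t)) = x (c + t)"
proof (rule lipschitz_ode_unique[OF F, of "\<bar>t\<bar>" "\<lambda>t. S (x (c - t))" "\<lambda>t. x (c + t)"])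
  fix s
  show "((\<lambda>t. S (x (c - t))) has_vector_derivative F (S (x (c - s)))) (at s)"
    using bounded_linear.has_vector_derivative[OF S has_vector_derivative_reflect[OF x], of c s]
    by (simp only: rev linear_neg[OF bounded_linear.linear[OF S]])
  show "((\<lambda>t. x (c + t)) has_vector_derivative F (x (c + s))) (at s)"
  proof -
    have "((+) c has_vector_derivative 1) (at s)" by (auto intro!: derivative_eq_intros)
    from vector_diff_chain_at[OF this x] show ?thesis by (simp add: o_def)
  qed
qed (use assms in auto)

section \<open>The Poincare-Miranda theorem on a rectangle\<close>

text \<open>
Apply Brouwer's theorem to \<open>z \<mapsto> z - (f z, g z)\<close> followed by the coordinatewise retraction onto the
rectangle. At a fixed point a nonzero value of \<open>f\<close> would have to be absorbed by the retraction,
which happens only on the left or right edge, and there the sign conditions exclude it; likewise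
for \<open>g\<close>.
\<close>

lemma poincare_miranda_rectangle:
  fixes f g :: "real \<times> real \<Rightarrow> real"
  assumes "a \<le> b" "c \<le> d"
    and f: "continuous_on ({a..b} \<times> {c..d}) f" and g: "continuous_on ({a..b} \<times> {c..d}) g"
    and left: "\<And>y. y \<in> {c..d} \<Longrightarrow> f (a, y) \<le> 0" and right: "\<And>y. y \<in> {c..d} \<Longrightarrow> f (b, y) \<ge> 0"
    and bottom: "\<And>x. x \<in> {a..b} \<Longrightarrow> g (x, c) \<le> 0" and top: "\<And>x. x \<in> {a..b} \<Longrightarrow> g (x, d) \<ge> 0"
  obtains x y where "x \<in> {a..b}" "y \<in> {c..d}" "f (x, y) = 0" "g (x, y) = 0"
proof -
  define h where "h z = (max a (min b (fst z - f z)), max c (min d (snd z - g z)))" for z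
  have "compact ({a..b} \<times> {c..d})" by (intro compact_Times) auto
  moreover have "convex ({a..b} \<times> {c..d})" by (intro convex_Times) auto
  moreover have "{a..b} \<times> {c..d} \<noteq> {}" using \<open>a \<le> b\<close> \<open>c \<le> d\<close> by auto
  moreover have "continuous_on ({a..b} \<times> {c..d}) h"
    unfolding h_def by (intro continuous_intros f g)
  moreover have "h \<in> ({a..b} \<times> {c..d}) \<rightarrow> {a..b} \<times> {c..d}"
    using \<open>a \<le> b\<close> \<open>c \<le> d\<close> by (auto simp: h_def)
  ultimately obtain z where z: "z \<in> {a..b} \<times> {c..d}" "h z = z"
    by (rule brouwer)
  obtain x y where xy: "z = (x, y)" by fastforce
  have mem: "x \<in> {a..b}" "y \<in> {c..d}" using z xy by auto
  have clamp_fixed: "v = 0"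
    if "l \<le> u" "max l (min u (s - v)) = s" "s = l \<Longrightarrow> v \<le> 0" "s = u \<Longrightarrow> v \<ge> 0" for l u s v :: real
    using that by (auto simp: max_def min_def split: if_splits)
  have fixed: "max a (min b (x - f (x, y))) = x" "max c (min d (y - g (x, y))) = y"
    using z by (simp_all add: h_def xy)
  have "f (x, y) = 0"
    using left[OF mem(2)] right[OF mem(2)] by (intro clamp_fixed[OF \<open>a \<le> b\<close> fixed(1)]) auto
  moreover have "g (x, y) = 0"
    using bottom[OF mem(1)] top[OF mem(1)] by (intro clamp_fixed[OF \<open>c \<le> d\<close> fixed(2)]) auto
  ultimately show thesis using that mem by blast
qed

section \<open>Bounded Lipschitz functions\<close>

text \<open>
Unlike the Lipschitz functions, the bounded ones among them are closed under products. This is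
what lets a field built from products and quotients be shown Lipschitz term by term once its
coordinates are clipped.
\<close>

definition bounded_lipschitz :: "('a::metric_space \<Rightarrow> 'b::real_normed_vector) \<Rightarrow> bool" where
  "bounded_lipschitz f \<longleftrightarrow> (\<exists>L. L-lipschitz_on UNIV f) \<and> (\<exists>B. \<forall>x. norm (f x) \<le> B)"

lemma bounded_lipschitz_const: "bounded_lipschitz (\<lambda>x. c)"
  unfolding bounded_lipschitz_def by (auto intro: lipschitz_on_constant)

lemma bounded_lipschitz_diff:
  assumes "bounded_lipschitz f" "bounded_lipschitz g"
  shows "bounded_lipschitz (\<lambda>x. f x - g x)"
proof -
  from assms obtain L K B C
    where "L-lipschitz_on UNIV f" "K-lipschitz_on UNIV g" "\<And>x. norm (f x) \<le> B" "\<And>x. norm (g x) \<le> C"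
    unfolding bounded_lipschitz_def by metis
  then have "(L + K)-lipschitz_on UNIV (\<lambda>x. f x - g x)" "\<And>x. norm (f x - g x) \<le> B + C"
    by (auto intro: lipschitz_on_diff norm_diff_triangle_le[THEN order_trans]
        order_trans[OF norm_triangle_ineq4 add_mono])
  then show ?thesis unfolding bounded_lipschitz_def by blast
qed

lemma bounded_lipschitz_mult:
  fixes f g :: "'a::metric_space \<Rightarrow> real"
  assumes "bounded_lipschitz f" "bounded_lipschitz g"
  shows "bounded_lipschitz (\<lambda>x. f x * g x)"
proof -
  from assms obtain L K B C
    where L: "L-lipschitz_on UNIV f" and K: "K-lipschitz_on UNIV g"
      and B: "\<And>x. norm (f x) \<le> B" and C: "\<And>x. norm (g x) \<le> C"
    unfolding bounded_lipschitz_def by metis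
  have nonneg: "L \<ge> 0" "K \<ge> 0" "B \<ge> 0" "C \<ge> 0"
    using L K B[of undefined] C[of undefined] norm_ge_zero order_trans lipschitz_on_nonneg by blast+
  have "(L * C + B * K)-lipschitz_on UNIV (\<lambda>x. f x * g x)"
  proof (rule lipschitz_onI)
    fix x y
    have "f x * g x - f y * g y = (f x - f y) * g x + f y * (g x - g y)"
      by (simp add: algebra_simps)
    then have "\<bar>f x * g x - f y * g y\<bar> \<le> \<bar>f x - f y\<bar> * \<bar>g x\<bar> + \<bar>f y\<bar> * \<bar>g x - g y\<bar>"
      by (metis abs_mult abs_triangle_ineq)
    also have "\<dots> \<le> (L * dist x y) * C + B * (K * dist x y)"
      using lipschitz_onD[OF L, of x y] lipschitz_onD[OF K, of x y] B[of y] C[of x] nonneg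
      by (intro add_mono mult_mono) (auto simp: dist_real_def)
    finally show "dist (f x * g x) (f y * g y) \<le> (L * C + B * K) * dist x y"
      by (simp add: dist_real_def algebra_simps)
  qed (use nonneg in auto)
  moreover have "norm (f x * g x) \<le> B * C" for x
    using B[of x] C[of x] nonneg by (auto simp: abs_mult intro!: mult_mono)
  ultimately show ?thesis unfolding bounded_lipschitz_def by blast
qed

lemma bounded_lipschitz_power:
  fixes f :: "'a::metric_space \<Rightarrow> real"
  assumes "bounded_lipschitz f"
  shows "bounded_lipschitz (\<lambda>x. f x ^ k)"
  by (induction k) (auto intro: bounded_lipschitz_const bounded_lipschitz_mult assms)

lemma bounded_lipschitz_inverse:
  fixes f :: "'a::metric_space \<Rightarrow> real"
  assumes "bounded_lipschitz f" and "c > 0" and c: "\<And>x. c \<le> f x"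
  shows "bounded_lipschitz (\<lambda>x. inverse (f x))"
proof -
  from assms(1) obtain L where L: "L-lipschitz_on UNIV f"
    unfolding bounded_lipschitz_def by metis
  have pos: "f x > 0" for x using c[of x] \<open>c > 0\<close> by simp
  have inv: "inverse (f x) \<le> inverse c" for x
    using c[of x] \<open>c > 0\<close> by (rule le_imp_inverse_le)
  have "(inverse c * inverse c * L)-lipschitz_on UNIV (\<lambda>x. inverse (f x))"
  proof (rule lipschitz_onI)
    fix x y
    have "dist (inverse (f x)) (inverse (f y)) = inverse (f x) * inverse (f y) * dist (f x) (f y)"
      using pos[of x] pos[of y]
      by (simp add: dist_real_def inverse_diff_inverse abs_mult abs_minus_commute)
    also have "\<dots> \<le> inverse c * inverse c * (L * dist x y)"
      using inv pos \<open>c > 0\<close> lipschitz_onD[OF L, of x y]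
      by (intro mult_mono) (auto simp: less_imp_le)
    finally show "dist (inverse (f x)) (inverse (f y)) \<le> inverse c * inverse c * L * dist x y"
      by (simp add: mult_ac)
  qed (use \<open>c > 0\<close> lipschitz_on_nonneg[OF L] in auto)
  moreover have "norm (inverse (f x)) \<le> inverse c" for x
    using inv[of x] pos[of x] by simp
  ultimately show ?thesis unfolding bounded_lipschitz_def by blast
qed

lemma bounded_lipschitz_norm_Pair:
  fixes f :: "'a::metric_space \<Rightarrow> 'b::real_normed_vector" and g :: "'a \<Rightarrow> 'c::real_normed_vector"
  assumes "bounded_lipschitz f" "bounded_lipschitz g"
  shows "bounded_lipschitz (\<lambda>x. norm (f x, g x))"
proof -
  from assms obtain L K B C
    where L: "L-lipschitz_on UNIV f" and K: "K-lipschitz_on UNIV g"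
      and B: "\<And>x. norm (f x) \<le> B" and C: "\<And>x. norm (g x) \<le> C"
    unfolding bounded_lipschitz_def by metis
  have "(sqrt (L\<^sup>2 + K\<^sup>2))-lipschitz_on UNIV (\<lambda>x. norm (f x, g x))"
  proof (rule lipschitz_onI)
    fix x y
    have "dist (norm (f x, g x)) (norm (f y, g y)) \<le> dist (f x, g x) (f y, g y)"
      by (simp add: dist_real_def dist_norm norm_triangle_ineq3 del: diff_Pair)
    also have "\<dots> \<le> sqrt (L\<^sup>2 + K\<^sup>2) * dist x y"
      by (rule lipschitz_onD[OF lipschitz_on_Pair[OF L K]]) auto
    finally show "dist (norm (f x, g x)) (norm (f y, g y)) \<le> sqrt (L\<^sup>2 + K\<^sup>2) * dist x y" .
  qed auto
  moreover have "norm (norm (f x, g x)) \<le> B + C" for x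
    using norm_Pair_le[of "f x" "g x"] B[of x] C[of x] by simp
  ultimately show ?thesis unfolding bounded_lipschitz_def by blast
qed

definition clip :: "real \<Rightarrow> real \<Rightarrow> real \<Rightarrow> real" where
  "clip l u x = max l (min u x)"

lemma clip_id: "l \<le> x \<Longrightarrow> x \<le> u \<Longrightarrow> clip l u x = x"
  by (simp add: clip_def)

lemma bounded_lipschitz_clip:
  assumes "L-lipschitz_on UNIV f"
  shows "bounded_lipschitz (\<lambda>x. clip l u (f x))"
proof -
  have "L-lipschitz_on UNIV (\<lambda>x. clip l u (f x))"
  proof (rule lipschitz_onI)
    fix x y
    have "dist (clip l u (f x)) (clip l u (f y)) \<le> dist (f x) (f y)"
      by (auto simp: clip_def dist_real_def)
    then show "dist (clip l u (f x)) (clip l u (f y)) \<le> L * dist x y"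
      using lipschitz_onD[OF assms, of x y] by simp
  qed (rule lipschitz_on_nonneg[OF assms])
  moreover have "norm (clip l u (f x)) \<le> \<bar>l\<bar> + \<bar>u\<bar>" for x
    by (auto simp: clip_def)
  ultimately show ?thesis unfolding bounded_lipschitz_def by blast
qed

section \<open>The first-order field and its truncation\<close>

type_synonym state = "real \<times> real \<times> real \<times> real \<times> real"

text \<open>
The state is \<open>(f, f', r, r', a\<^sup>2)\<close>. The last coordinate is constant along orbits; having it in the
state turns the dependence on \<open>a\<close> into dependence on the initial state.
\<close>

definition reduced_field :: "nat \<Rightarrow> real \<Rightarrow> real \<Rightarrow> real \<Rightarrow> state \<Rightarrow> state" where
  "reduced_field n m M r0 = (\<lambda>(f, v, r, w, p).
    (v, - ((M + m * real n) * f) / (hdist n m M f r) ^ 3,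
     w, r0\<^sup>2 * p / r ^ 3 - m * lam n / r\<^sup>2 - M * r / (hdist n m M f r) ^ 3,
     0))"

text \<open>
The velocities enter the field linearly and therefore stay unclipped. The interval for \<open>f\<close> is
symmetric so that the reversal commutes with the truncation.
\<close>

definition truncate :: "real \<Rightarrow> real \<Rightarrow> state \<Rightarrow> state" where
  "truncate \<rho> B = (\<lambda>(f, v, r, w, p). (clip (- B) B f, v, clip \<rho> B r, w, clip (- B) B p))"

text \<open>
As a Euclidean norm the distance is visibly Lipschitz in its arguments.
\<close>

lemma hdist_norm: "hdist n m M f r = norm (r, (M + real n * m) / (m * real n) * f)"
  by (simp add: hdist_def norm_Pair power_mult_distrib power_divide)

lemma hdist_ge: "r \<le> hdist n m M f r"
  using norm_fst_le[of r "(M + real n * m) / (m * real n) * f"] unfolding hdist_norm by simp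

text \<open>
After clipping, the only denominators \<open>r\<close> and \<open>hdist\<close> are at least \<open>\<rho>\<close>, so that each term is a
product of bounded Lipschitz functions.
\<close>

proposition truncated_field_lipschitz:
  assumes "\<rho> > 0"
  obtains L where "L-lipschitz_on UNIV (\<lambda>z. reduced_field n m M r0 (truncate \<rho> B z))"
proof -
  define f where "f z = clip (- B) B (fst z)" for z :: state
  define r where "r z = clip \<rho> B (fst (snd (snd z)))" for z :: state
  define p where "p z = clip (- B) B (snd (snd (snd (snd z))))" for z :: state
  define h where "h z = hdist n m M (f z) (r z)" for z
  have lin: "\<exists>L. L-lipschitz_on UNIV g" if "bounded_linear g" for g :: "state \<Rightarrow> real"
    using bounded_linear.lipschitz_boundE[OF that] by metis
  have proj: "bounded_linear (\<lambda>z::state. fst z)" "bounded_linear (\<lambda>z::state. fst (snd z))"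
    "bounded_linear (\<lambda>z::state. fst (snd (snd z)))" "bounded_linear (\<lambda>z::state. fst (snd (snd (snd z))))"
    "bounded_linear (\<lambda>z::state. snd (snd (snd (snd z))))"
    by (intro bounded_linear_intros)+
  have f: "bounded_lipschitz f" and r: "bounded_lipschitz r" and p: "bounded_lipschitz p"
    unfolding f_def r_def p_def using lin[OF proj(1)] lin[OF proj(3)] lin[OF proj(5)]
    by (auto intro: bounded_lipschitz_clip)
  have r_ge: "\<rho> \<le> r z" for z by (simp add: r_def clip_def)
  then have h_ge: "\<rho> \<le> h z" for z
    unfolding h_def using hdist_ge order_trans by blast
  have h: "bounded_lipschitz h"
    unfolding h_def hdist_norm
    by (intro bounded_lipschitz_norm_Pair bounded_lipschitz_mult bounded_lipschitz_const f r)
  note ih = bounded_lipschitz_inverse[OF h assms h_ge]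
  note ir = bounded_lipschitz_inverse[OF r assms r_ge]
  have "bounded_lipschitz (\<lambda>z. (- (M + m * real n)) * f z * inverse (h z) ^ 3)"
    by (intro bounded_lipschitz_mult bounded_lipschitz_power bounded_lipschitz_const f ih)
  then obtain L2 where L2: "L2-lipschitz_on UNIV (\<lambda>z. (- (M + m * real n)) * f z * inverse (h z) ^ 3)"
    unfolding bounded_lipschitz_def by blast
  have "bounded_lipschitz (\<lambda>z. r0\<^sup>2 * p z * inverse (r z) ^ 3 - m * lam n * inverse (r z) ^ 2
      - M * r z * inverse (h z) ^ 3)"
    by (intro bounded_lipschitz_diff bounded_lipschitz_mult bounded_lipschitz_power
        bounded_lipschitz_const r p ih ir)
  then obtain L4 where L4: "L4-lipschitz_on UNIV
      (\<lambda>z. r0\<^sup>2 * p z * inverse (r z) ^ 3 - m * lam n * inverse (r z) ^ 2 - M * r z * inverse (h z) ^ 3)"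
    unfolding bounded_lipschitz_def by blast
  obtain L1 L3 where L1: "L1-lipschitz_on UNIV (\<lambda>z::state. fst (snd z))"
    and L3: "L3-lipschitz_on UNIV (\<lambda>z::state. fst (snd (snd (snd z))))"
    using lin[OF proj(2)] lin[OF proj(4)] by blast
  have eq: "(\<lambda>z. reduced_field n m M r0 (truncate \<rho> B z)) =
    (\<lambda>z. (fst (snd z), (- (M + m * real n)) * f z * inverse (h z) ^ 3, fst (snd (snd (snd z))),
      r0\<^sup>2 * p z * inverse (r z) ^ 3 - m * lam n * inverse (r z) ^ 2 - M * r z * inverse (h z) ^ 3,
      0::real))"
    by (auto simp: fun_eq_iff reduced_field_def truncate_def f_def r_def p_def h_def
        divide_inverse power_inverse algebra_simps)
  show thesis
    by (rule that, unfold eq)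
      (rule lipschitz_on_Pair[OF L1 lipschitz_on_Pair[OF L2 lipschitz_on_Pair[OF L3
            lipschitz_on_Pair[OF L4 lipschitz_on_constant]]]])
qed

lemma truncate_id:
  assumes "\<bar>f\<bar> \<le> B" "\<rho> \<le> r" "r \<le> B" "\<bar>p\<bar> \<le> B"
  shows "truncate \<rho> B (f, v, r, w, p) = (f, v, r, w, p)"
  using assms by (auto simp: truncate_def clip_id abs_le_iff)

lemma truncate_eventually_id:
  assumes "0 < \<rho>" "\<rho> < r0" "r0 < B" "\<bar>p\<bar> < B"
  shows "\<forall>\<^sub>F z in nhds (0, v, r0, w, p). truncate \<rho> B z = z"
proof -
  have "open ({-B<..<B} \<times> (UNIV::real set) \<times> {\<rho><..<B} \<times> (UNIV::real set) \<times> {-B<..<B})"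
    by (intro open_Times open_greaterThanLessThan open_UNIV)
  then have "\<forall>\<^sub>F z in nhds (0, v, r0, w, p).
      z \<in> {-B<..<B} \<times> (UNIV::real set) \<times> {\<rho><..<B} \<times> (UNIV::real set) \<times> {-B<..<B}"
    by (rule eventually_nhds_in_open) (use assms in auto)
  then show ?thesis
    by eventually_elim (auto intro!: truncate_id)
qed

definition time_reversal :: "state \<Rightarrow> state" where
  "time_reversal = (\<lambda>(f, v, r, w, p). (- f, v, r, - w, p))"

lemma bounded_linear_time_reversal: "bounded_linear time_reversal"
  unfolding time_reversal_def case_prod_unfold
  by (intro bounded_linear_intros bounded_linear_minus)

text \<open>
The accelerations are odd in \<open>f\<close> for \<open>f''\<close> and even in \<open>f\<close> for \<open>r''\<close>, because \<open>f\<close> enters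
\<open>hdist\<close> only through its square.
\<close>

lemma truncated_field_reversible:
  assumes "B \<ge> 0"
  shows "reduced_field n m M r0 (truncate \<rho> B (time_reversal z)) =
    - time_reversal (reduced_field n m M r0 (truncate \<rho> B z))"
proof -
  have "clip (- B) B (- f) = - clip (- B) B f" for f
    using assms by (auto simp: clip_def)
  moreover have "hdist n m M (- f) r = hdist n m M f r" for f r
    by (simp add: hdist_def)
  ultimately show ?thesis
    by (cases z) (simp add: reduced_field_def truncate_def time_reversal_def)
qed

definition linearized_field :: "real \<Rightarrow> real \<Rightarrow> real \<Rightarrow> state \<Rightarrow> state" where
  "linearized_field s1 s2 r0 = (\<lambda>(f, v, r, w, p). (v, - s1 * f, w, p / r0 - s2 * r, 0))"

lemma has_derivative_state_projections:
  fixes F :: "state filter"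
  shows "((\<lambda>z. fst z) has_derivative (\<lambda>z. fst z)) F"
    "((\<lambda>z. fst (snd z)) has_derivative (\<lambda>z. fst (snd z))) F"
    "((\<lambda>z. fst (snd (snd z))) has_derivative (\<lambda>z. fst (snd (snd z)))) F"
    "((\<lambda>z. fst (snd (snd (snd z)))) has_derivative (\<lambda>z. fst (snd (snd (snd z))))) F"
    "((\<lambda>z. snd (snd (snd (snd z)))) has_derivative (\<lambda>z. snd (snd (snd (snd z))))) F"
  by (intro bounded_linear_imp_has_derivative bounded_linear_intros)+

text \<open>
At \<open>f = 0\<close> the distance depends on \<open>f\<close> only to second order.
\<close>

lemma hdist_has_derivative_on_plane:
  assumes "r0 > 0"
  shows "((\<lambda>z. hdist n m M (fst z) (fst (snd (snd z)))) has_derivative (\<lambda>z. fst (snd (snd z))))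
    (at (0, v :: real, r0, w :: real, p :: real))"
proof -
  let ?c = "(M + real n * m) / (m * real n)"
  let ?z = "(0, v, r0, w, p) :: state"
  have "((\<lambda>x. x\<^sup>2) has_real_derivative 2 * y) (at y)" for y :: real
    by (auto intro!: derivative_eq_intros)
  note sq = DERIV_compose_FDERIV[OF this]
  have "((\<lambda>z. (fst (snd (snd z)))\<^sup>2 + ?c\<^sup>2 * (fst z)\<^sup>2) has_derivative
      (\<lambda>z. fst (snd (snd z)) * (2 * fst (snd (snd ?z))) + ?c\<^sup>2 * (fst z * (2 * fst ?z)))) (at ?z)"
    by (intro has_derivative_add has_derivative_mult_right sq has_derivative_state_projections)
  from has_derivative_real_sqrt[OF _ this]
  show ?thesis using assms by (simp add: hdist_def)
qed

text \<open>
The value of \<open>p\<close> is the one for which the centrifugal term balances the attraction. It also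
collapses the coefficient of \<open>r\<close>: \<open>- 3 p / r0\<^sup>2 + 2 (lam n * m + M) / r0\<^sup>3\<close> becomes
\<open>- (lam n * m + M) / r0\<^sup>3\<close>.
\<close>

lemma reduced_field_has_derivative_at_equilibrium:
  assumes "r0 > 0" and p: "p = (lam n * m + M) / r0"
  shows "(reduced_field n m M r0 has_derivative
      linearized_field ((real n * m + M) / r0 ^ 3) ((lam n * m + M) / r0 ^ 3) r0)
    (at (0, 0, r0, 0, p))"
proof -
  let ?h = "\<lambda>z::state. hdist n m M (fst z) (fst (snd (snd z)))"
  let ?z = "(0, 0, r0, 0, p) :: state"
  note proj = has_derivative_state_projections
  note h = hdist_has_derivative_on_plane[OF assms(1), of n m M 0 0 p]
  have h0: "hdist n m M 0 r0 = r0" using assms(1) by (simp add: hdist_def)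
  have inv_cube: "((\<lambda>z. inverse (g z ^ 3)) has_derivative (\<lambda>z. g' z * (- 3 / r0 ^ 4))) (at ?z)"
    if "(g has_derivative g') (at ?z)" "g ?z = r0" for g g' :: "state \<Rightarrow> real"
  proof (rule DERIV_compose_FDERIV[OF _ that(1)])
    show "((\<lambda>x. inverse (x ^ 3)) has_real_derivative - 3 / r0 ^ 4) (at (g ?z))"
      using \<open>r0 > 0\<close> that(2)
      by (auto intro!: derivative_eq_intros simp: field_simps eval_nat_numeral)
  qed
  have inv_square: "((\<lambda>z. inverse ((fst (snd (snd z)))\<^sup>2)) has_derivative
      (\<lambda>z. fst (snd (snd z)) * (- 2 / r0 ^ 3))) (at ?z)"
  proof (rule DERIV_compose_FDERIV[OF _ proj(3)])
    show "((\<lambda>x. inverse (x\<^sup>2)) has_real_derivative - 2 / r0 ^ 3) (at (fst (snd (snd ?z))))"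
      using \<open>r0 > 0\<close> by (auto intro!: derivative_eq_intros simp: field_simps eval_nat_numeral)
  qed
  note inv_h = inv_cube[OF h, simplified, OF h0]
  note inv_r = inv_cube[OF proj(3), simplified]
  have 2: "((\<lambda>z::state. - ((M + m * real n) * fst z) * inverse (?h z ^ 3)) has_derivative
      (\<lambda>z. - ((real n * m + M) / r0 ^ 3) * fst z)) (at ?z)"
    by (rule has_derivative_eq_rhs, rule has_derivative_mult[OF _ inv_h])
      (rule has_derivative_minus has_derivative_mult_right proj |
        (use \<open>r0 > 0\<close> h0 in \<open>auto simp: fun_eq_iff field_simps\<close>))+
  have A: "((\<lambda>z::state. r0\<^sup>2 * snd (snd (snd (snd z))) * inverse (fst (snd (snd z)) ^ 3)) has_derivative
      (\<lambda>z. snd (snd (snd (snd z))) / r0 - 3 * p / r0\<^sup>2 * fst (snd (snd z)))) (at ?z)"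
    by (rule has_derivative_eq_rhs, rule has_derivative_mult[OF _ inv_r])
      (rule has_derivative_mult_right proj |
        (use \<open>r0 > 0\<close> in \<open>auto simp: fun_eq_iff field_simps eval_nat_numeral\<close>))+
  have B: "((\<lambda>z::state. m * lam n * inverse ((fst (snd (snd z)))\<^sup>2)) has_derivative
      (\<lambda>z. - 2 * m * lam n / r0 ^ 3 * fst (snd (snd z)))) (at ?z)"
    by (rule has_derivative_eq_rhs, rule has_derivative_mult_right[OF inv_square])
      (simp add: fun_eq_iff)
  have C: "((\<lambda>z::state. M * fst (snd (snd z)) * inverse (?h z ^ 3)) has_derivative
      (\<lambda>z. - 2 * M / r0 ^ 3 * fst (snd (snd z)))) (at ?z)"
    by (rule has_derivative_eq_rhs, rule has_derivative_mult[OF _ inv_h])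
      (rule has_derivative_mult_right proj |
        (use \<open>r0 > 0\<close> h0 in \<open>auto simp: fun_eq_iff field_simps eval_nat_numeral\<close>))+
  have 4: "((\<lambda>z::state. r0\<^sup>2 * snd (snd (snd (snd z))) * inverse (fst (snd (snd z)) ^ 3)
        - m * lam n * inverse ((fst (snd (snd z)))\<^sup>2) - M * fst (snd (snd z)) * inverse (?h z ^ 3))
      has_derivative
      (\<lambda>z. snd (snd (snd (snd z))) / r0 - ((lam n * m + M) / r0 ^ 3) * fst (snd (snd z))))
      (at ?z)"
    by (rule has_derivative_eq_rhs, rule has_derivative_diff[OF has_derivative_diff[OF A B] C])
      (use \<open>r0 > 0\<close> in \<open>simp add: p fun_eq_iff field_simps eval_nat_numeral\<close>)
  from has_derivative_Pair[OF proj(2) has_derivative_Pair[OF 2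
      has_derivative_Pair[OF proj(4) has_derivative_Pair[OF 4 has_derivative_const]]]]
  show ?thesis
    by (simp add: reduced_field_def linearized_field_def case_prod_unfold divide_inverse)
qed

lemma reduced_solution_state_curve:
  assumes "reduced_solution n m M r0 a f r"
  shows "((\<lambda>t. (f t, deriv f t, r t, deriv r t, a\<^sup>2)) has_vector_derivative
    reduced_field n m M r0 (f t, deriv f t, r t, deriv r t, a\<^sup>2)) (at t)"
  using assms unfolding reduced_solution_def reduced_field_def
  by (auto intro!: has_vector_derivative_Pair derivative_intros
      simp flip: has_real_derivative_iff_has_vector_derivative)

text \<open>
On a compact time interval both solutions stay in a region \<open>\<bar>f\<bar> \<le> B\<close>, \<open>\<rho> \<le> r \<le> B\<close>, where the
truncation acts as the identity. Hence both solve one globally Lipschitz equation there.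
\<close>

proposition reduced_ivp_solution_unique:
  assumes "reduced_ivp_solution n m M r0 a b f r" "reduced_ivp_solution n m M r0 a b f' r'"
  shows "f t = f' t \<and> r t = r' t"
proof -
  let ?X = "\<lambda>t. (f t, deriv f t, r t, deriv r t, a\<^sup>2)"
  let ?Y = "\<lambda>t. (f' t, deriv f' t, r' t, deriv r' t, a\<^sup>2)"
  define I where "I = {-\<bar>t\<bar>..\<bar>t\<bar>}"
  have X: "reduced_solution n m M r0 a f r" and Y: "reduced_solution n m M r0 a f' r'"
    using assms unfolding reduced_ivp_solution_def by auto
  have "isCont f s" "isCont f' s" "isCont r s" "isCont r' s" for s
    using X Y unfolding reduced_solution_def by (meson DERIV_isCont)+
  then have cont: "continuous_on I f" "continuous_on I f'" "continuous_on I r" "continuous_on I r'"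
    by (simp_all add: continuous_at_imp_continuous_on)
  have I: "compact I" "I \<noteq> {}" by (auto simp: I_def)
  obtain s0 where "\<And>s. s \<in> I \<Longrightarrow> min (r s0) (r' s0) \<le> min (r s) (r' s)"
    using continuous_attains_inf[OF I, of "\<lambda>s. min (r s) (r' s)"] cont
    by (auto intro!: continuous_intros)
  moreover define \<rho> where "\<rho> = min (r s0) (r' s0)"
  ultimately have \<rho>: "\<rho> \<le> r s" "\<rho> \<le> r' s" if "s \<in> I" for s using that by fastforce+
  have pos: "r s > 0" "r' s > 0" for s
    using X Y unfolding reduced_solution_def by auto
  have "\<rho> > 0" using pos by (simp add: \<rho>_def)
  obtain s1 where s1: "\<And>s. s \<in> I \<Longrightarrow>
      \<bar>f s\<bar> + \<bar>f' s\<bar> + r s + r' s \<le> \<bar>f s1\<bar> + \<bar>f' s1\<bar> + r s1 + r' s1"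
  proof -
    have "continuous_on I (\<lambda>s. \<bar>f s\<bar> + \<bar>f' s\<bar> + r s + r' s)"
      by (intro continuous_intros cont)
    from continuous_attains_sup[OF I this] show ?thesis using that by blast
  qed
  define B where "B = \<bar>f s1\<bar> + \<bar>f' s1\<bar> + r s1 + r' s1 + a\<^sup>2"
  have B: "\<bar>f s\<bar> \<le> B \<and> \<bar>f' s\<bar> \<le> B \<and> r s \<le> B \<and> r' s \<le> B" if "s \<in> I" for s
    using s1[OF that] pos[of s] unfolding B_def by (auto intro: order_trans simp: add_increasing2)
  have aB: "\<bar>a\<^sup>2\<bar> \<le> B" using pos[of s1] by (auto simp: B_def)
  obtain L where L: "L-lipschitz_on UNIV (\<lambda>z. reduced_field n m M r0 (truncate \<rho> B z))"
    using truncated_field_lipschitz[OF \<open>\<rho> > 0\<close>] .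
  have "?X t = ?Y t"
  proof (rule lipschitz_ode_unique[OF L, of "\<bar>t\<bar>" ?X ?Y])
    fix s assume "\<bar>s\<bar> \<le> \<bar>t\<bar>"
    then have s: "s \<in> I" by (auto simp: I_def)
    have "truncate \<rho> B (?X s) = ?X s" "truncate \<rho> B (?Y s) = ?Y s"
      using B[OF s] \<rho>[OF s] aB by (auto intro!: truncate_id)
    then show "(?X has_vector_derivative reduced_field n m M r0 (truncate \<rho> B (?X s))) (at s)"
      and "(?Y has_vector_derivative reduced_field n m M r0 (truncate \<rho> B (?Y s))) (at s)"
      using reduced_solution_state_curve[OF X, of s] reduced_solution_state_curve[OF Y, of s]
      by simp_all
  qed (use assms in \<open>auto simp: reduced_ivp_solution_def\<close>)
  then show ?thesis by simp
qed

lemma has_vector_derivative_PairD: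
  assumes "((\<lambda>t. (x t, y t)) has_vector_derivative (x', y')) (at t)"
  shows "(x has_vector_derivative x') (at t)" "(y has_vector_derivative y') (at t)"
  using bounded_linear.has_vector_derivative[OF bounded_linear_fst assms]
    bounded_linear.has_vector_derivative[OF bounded_linear_snd assms] by simp_all

lemma state_curve_reduced_solution:
  fixes f v r w p :: "real \<Rightarrow> real"
  assumes X: "\<And>t. ((\<lambda>t. (f t, v t, r t, w t, p t)) has_vector_derivative
      reduced_field n m M r0 (f t, v t, r t, w t, p t)) (at t)"
    and pos: "\<And>t. r t > 0" and p0: "p 0 = a\<^sup>2"
  shows "reduced_solution n m M r0 a f r" "deriv f = v" "deriv r = w"
proof -
  note D = X[unfolded reduced_field_def split]
  note D2 = has_vector_derivative_PairD(2)[OF D]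
  note D3 = has_vector_derivative_PairD(2)[OF D2]
  note D4 = has_vector_derivative_PairD(2)[OF D3]
  note E = has_vector_derivative_PairD(1)[OF D] has_vector_derivative_PairD(1)[OF D2]
    has_vector_derivative_PairD(1)[OF D3] has_vector_derivative_PairD(1)[OF D4]
    has_vector_derivative_PairD(2)[OF D4]
  note R = E[folded has_real_derivative_iff_has_vector_derivative]
  show v: "deriv f = v" and w: "deriv r = w" using R(1,3) by (auto intro: DERIV_imp_deriv)
  have "p t = a\<^sup>2" for t using DERIV_isconst_all[of p t 0] R(5) p0 by simp
  then show "reduced_solution n m M r0 a f r"
    using R pos unfolding reduced_solution_def v w by simp
qed

section \<open>Periodicity from the reversing symmetry\<close>

lemma periodic_int_multiple:
  fixes x :: "real \<Rightarrow> 'a"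
  assumes "\<And>t. x (t + c) = x t"
  shows "x (t + of_int k * c) = x t"
proof (induction k rule: int_induct[where k = 0])
  case (step1 i)
  then show ?case using assms[of "t + of_int i * c"] by (simp add: algebra_simps)
next
  case (step2 i)
  then show ?case using assms[of "t + of_int (i - 1) * c"] by (simp add: algebra_simps)
qed simp

text \<open>
The conditions \<open>f = 0\<close>, \<open>r' = 0\<close> at the times \<open>0\<close> and \<open>T\<close> say that the reversal fixes the state
there. The orbit is then symmetric about both times; composing the two reflections gives the period
\<open>2 T\<close>. Up to the symmetries every time lies in \<open>{0..T}\<close>, so that control of the orbit on that arc
suffices to know that it never leaves the region where the truncation is the identity.
\<close>

proposition reversible_arc_gives_periodic_solution:
  fixes X :: "real \<Rightarrow> state"
  assumes "\<rho> > 0" "B \<ge> 0" "T > 0"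
    and X: "\<And>t. (X has_vector_derivative reduced_field n m M r0 (truncate \<rho> B (X t))) (at t)"
    and X0: "X 0 = (0, b, r0, 0, a\<^sup>2)"
    and XT: "fst (X T) = 0" "fst (snd (snd (snd (X T)))) = 0"
    and arc: "\<And>t. t \<in> {0..T} \<Longrightarrow> \<bar>fst (X t)\<bar> \<le> B \<and> \<rho> \<le> fst (snd (snd (X t))) \<and>
      fst (snd (snd (X t))) \<le> B \<and> \<bar>snd (snd (snd (snd (X t))))\<bar> \<le> B"
  shows "odd_periodic_solution n m M r0 a b T (\<lambda>t. fst (X t)) (\<lambda>t. fst (snd (snd (X t))))"
proof -
  let ?F = "\<lambda>z. reduced_field n m M r0 (truncate \<rho> B z)"
  let ?R = time_reversal
  define inside :: "state \<Rightarrow> bool" where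
    "inside z \<longleftrightarrow> \<bar>fst z\<bar> \<le> B \<and> \<rho> \<le> fst (snd (snd z)) \<and> fst (snd (snd z)) \<le> B \<and>
      \<bar>snd (snd (snd (snd z)))\<bar> \<le> B" for z
  obtain L where L: "L-lipschitz_on UNIV ?F"
    using truncated_field_lipschitz[OF \<open>\<rho> > 0\<close>] .
  note symmetric = reversible_orbit_symmetric[OF L bounded_linear_time_reversal
      truncated_field_reversible[OF \<open>B \<ge> 0\<close>] X]
  have fixed: "?R (X 0) = X 0" "?R (X T) = X T"
    using XT by (auto simp: X0 time_reversal_def case_prod_unfold prod_eq_iff)
  have even: "?R (X (- t)) = X t" for t
    using symmetric[OF fixed(1), of t] by simp
  have invol: "?R (?R z) = z" for z by (cases z) (simp add: time_reversal_def)
  have periodic: "X (t + 2 * T) = X t" for t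
    using symmetric[OF fixed(2), of "T + t"] even[of t] by (simp add: algebra_simps)
  have inside: "inside (X t)" for t
  proof -
    \<comment> \<open>Shift \<open>t\<close> by a multiple of the period to some \<open>s\<close> with \<open>\<bar>s\<bar> \<le> T\<close>.\<close>
    define k where "k = round (t / (2 * T))"
    define s where "s = t + of_int (- k) * (2 * T)"
    have "\<bar>of_int k - t / (2 * T)\<bar> \<le> 1 / 2" unfolding k_def by (rule of_int_round_abs_le)
    then have "\<bar>of_int k - t / (2 * T)\<bar> * (2 * T) \<le> 1 / 2 * (2 * T)"
      using \<open>T > 0\<close> by (intro mult_right_mono) auto
    moreover have "\<bar>s\<bar> = \<bar>of_int k - t / (2 * T)\<bar> * (2 * T)"
    proof -
      have "s = - ((of_int k - t / (2 * T)) * (2 * T))"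
        using \<open>T > 0\<close> by (simp add: s_def field_simps)
      then show ?thesis using \<open>T > 0\<close> by (simp add: abs_mult)
    qed
    ultimately have s: "\<bar>s\<bar> \<le> T" by simp
    have "X s = X t"
      unfolding s_def by (rule periodic_int_multiple[where x = X, OF periodic])
    moreover have "inside (X s)"
    proof (cases "s \<ge> 0")
      case True
      then show ?thesis using arc[of s] s by (simp add: inside_def)
    next
      case False
      then have "inside (X (- s))" using arc[of "- s"] s by (simp add: inside_def)
      then show ?thesis
        using even[of s] by (auto simp: inside_def time_reversal_def case_prod_unfold prod_eq_iff)
    qed
    ultimately show ?thesis by simp
  qed
  then have "truncate \<rho> B (X t) = X t" for t
    using truncate_id[of "fst (X t)" B \<rho> "fst (snd (snd (X t)))" "snd (snd (snd (snd (X t))))"]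
    unfolding inside_def by (metis prod.collapse)
  then have curve: "((\<lambda>t. (fst (X t), fst (snd (X t)), fst (snd (snd (X t))), fst (snd (snd (snd (X t)))),
        snd (snd (snd (snd (X t)))))) has_vector_derivative
      reduced_field n m M r0 (fst (X t), fst (snd (X t)), fst (snd (snd (X t))),
        fst (snd (snd (snd (X t)))), snd (snd (snd (snd (X t)))))) (at t)" for t
    using X[of t] by simp
  have pos: "fst (snd (snd (X t))) > 0" for t
    using inside[of t] \<open>\<rho> > 0\<close> by (simp add: inside_def)
  note sol = state_curve_reduced_solution[OF curve pos, of a]
  show ?thesis
    unfolding odd_periodic_solution_def reduced_ivp_solution_def
    using sol XT \<open>T > 0\<close> by (simp add: X0 periodic)
qed

section \<open>The linearized orbit and nonresonance\<close>

lemma lam_pos: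
  assumes "n \<ge> 2"
  shows "lam n > 0"
proof -
  have "sin (real k * pi / real n) > 0" if "k \<in> {1..n - 1}" for k
  proof (rule sin_gt_zero)
    show "0 < real k * pi / real n" using that assms by auto
    show "real k * pi / real n < pi"
      using that assms by (auto simp: divide_less_eq)
  qed
  then have "(\<Sum>k = 1..n - 1. 1 / sin (real k * pi / real n)) > 0"
    using assms by (intro sum_pos) auto
  then show ?thesis by (simp add: lam_def)
qed

lemma abs_components_le_norm:
  fixes z :: state
  shows "\<bar>fst z\<bar> \<le> norm z" "\<bar>fst (snd (snd z))\<bar> \<le> norm z"
    "\<bar>fst (snd (snd (snd z)))\<bar> \<le> norm z" "\<bar>snd (snd (snd (snd z)))\<bar> \<le> norm z"
proof -
  have proj: "norm (fst x) \<le> norm x" "norm (snd x) \<le> norm x"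
    for x :: "'a::real_normed_vector \<times> 'b::real_normed_vector"
    by (metis norm_fst_le norm_snd_le prod.collapse)+
  note tails = proj(2)[of z] proj(2)[of "snd z"] proj(2)[of "snd (snd z)"]
    proj(2)[of "snd (snd (snd z))"]
  show "\<bar>fst z\<bar> \<le> norm z" "\<bar>fst (snd (snd z))\<bar> \<le> norm z"
    "\<bar>fst (snd (snd (snd z)))\<bar> \<le> norm z" "\<bar>snd (snd (snd (snd z)))\<bar> \<le> norm z"
    using tails proj(1)[of z] proj(1)[of "snd (snd z)"] proj(1)[of "snd (snd (snd z))"]
    unfolding real_norm_def by linarith+
qed

text \<open>
The solution of the linearized equation that starts in the direction \<open>(0, 1, 0, 0, \<alpha>)\<close>.
\<close>

definition linearized_orbit :: "real \<Rightarrow> real \<Rightarrow> real \<Rightarrow> real \<Rightarrow> real \<Rightarrow> state" where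
  "linearized_orbit \<omega>1 \<omega>2 r0 \<alpha> t =
    (sin (\<omega>1 * t) / \<omega>1, cos (\<omega>1 * t), \<alpha> / (r0 * \<omega>2\<^sup>2) * (1 - cos (\<omega>2 * t)),
     \<alpha> / (r0 * \<omega>2) * sin (\<omega>2 * t), \<alpha>)"

lemma linearized_orbit_0: "linearized_orbit \<omega>1 \<omega>2 r0 \<alpha> 0 = (0, 1, 0, 0, \<alpha>)"
  by (simp add: linearized_orbit_def)

lemma linearized_orbit_solves:
  assumes "\<omega>1 > 0" "\<omega>2 > 0" "r0 > 0"
  shows "(linearized_orbit \<omega>1 \<omega>2 r0 \<alpha> has_vector_derivative
    linearized_field (\<omega>1\<^sup>2) (\<omega>2\<^sup>2) r0 (linearized_orbit \<omega>1 \<omega>2 r0 \<alpha> t)) (at t)"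
proof -
  have "((\<lambda>t. sin (\<omega>1 * t) / \<omega>1) has_real_derivative cos (\<omega>1 * t)) (at t)"
    "((\<lambda>t. cos (\<omega>1 * t)) has_real_derivative - \<omega>1\<^sup>2 * (sin (\<omega>1 * t) / \<omega>1)) (at t)"
    "((\<lambda>t. \<alpha> / (r0 * \<omega>2\<^sup>2) * (1 - cos (\<omega>2 * t))) has_real_derivative
      \<alpha> / (r0 * \<omega>2) * sin (\<omega>2 * t)) (at t)"
    "((\<lambda>t. \<alpha> / (r0 * \<omega>2) * sin (\<omega>2 * t)) has_real_derivative
      \<alpha> / r0 - \<omega>2\<^sup>2 * (\<alpha> / (r0 * \<omega>2\<^sup>2) * (1 - cos (\<omega>2 * t)))) (at t)"
    using assms
    by (auto intro!: derivative_eq_intros simp: field_simps power2_eq_square)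
  then show ?thesis
    unfolding linearized_orbit_def[abs_def] linearized_field_def split
    by (intro has_vector_derivative_Pair has_vector_derivative_const)
      (simp_all flip: has_real_derivative_iff_has_vector_derivative)
qed

lemma linearized_orbit_bounded:
  assumes "\<omega>1 > 0" "\<omega>2 > 0" "r0 > 0" "\<bar>\<alpha>\<bar> \<le> 1"
  shows "norm (linearized_orbit \<omega>1 \<omega>2 r0 \<alpha> t) \<le>
    1 / \<omega>1 + (1 + (2 / (r0 * \<omega>2\<^sup>2) + (1 / (r0 * \<omega>2) + 1)))"
  unfolding linearized_orbit_def
proof (intro order_trans[OF norm_Pair_le] add_mono)
  show "norm (sin (\<omega>1 * t) / \<omega>1) \<le> 1 / \<omega>1"
    using assms by (simp add: divide_right_mono)
  have "\<bar>1 - cos (\<omega>2 * t)\<bar> \<le> 2"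
    using cos_ge_minus_one[of "\<omega>2 * t"] cos_le_one[of "\<omega>2 * t"] by simp
  then have "\<bar>\<alpha>\<bar> * \<bar>1 - cos (\<omega>2 * t)\<bar> \<le> 1 * 2"
    using assms(4) by (intro mult_mono) auto
  then show "norm (\<alpha> / (r0 * \<omega>2\<^sup>2) * (1 - cos (\<omega>2 * t))) \<le> 2 / (r0 * \<omega>2\<^sup>2)"
    using assms by (simp add: abs_mult divide_right_mono)
  have "\<bar>\<alpha>\<bar> * \<bar>sin (\<omega>2 * t)\<bar> \<le> 1 * 1"
    using assms(4) by (intro mult_mono) auto
  then show "norm (\<alpha> / (r0 * \<omega>2) * sin (\<omega>2 * t)) \<le> 1 / (r0 * \<omega>2)"
    using assms by (simp add: abs_mult divide_right_mono)
qed (use assms in auto)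

text \<open>
A zero of the sine means \<open>\<omega>2 = p \<omega>1\<close> for a positive integer \<open>p\<close>. Squaring and solving for \<open>l\<close>
gives exactly the excluded value.
\<close>

lemma nonresonance:
  assumes "m > 0" "r0 > 0" "\<omega>1 > 0" "\<omega>2 > 0"
    and \<omega>1: "\<omega>1\<^sup>2 = (real n * m + M) / r0 ^ 3" and \<omega>2: "\<omega>2\<^sup>2 = (l * m + M) / r0 ^ 3"
    and l: "\<And>p::nat. p \<ge> 1 \<Longrightarrow> l \<noteq> real n * (real p)\<^sup>2 + M / m * ((real p)\<^sup>2 - 1)"
  shows "sin (\<omega>2 * (pi / \<omega>1)) \<noteq> 0"
proof
  assume "sin (\<omega>2 * (pi / \<omega>1)) = 0"
  then obtain k :: int where "\<omega>2 * (pi / \<omega>1) = of_int k * pi"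
    unfolding sin_zero_iff_int2 by blast
  then have k: "\<omega>2 = of_int k * \<omega>1"
    using \<open>\<omega>1 > 0\<close> by (simp add: field_simps)
  then have "k > 0" using \<open>\<omega>1 > 0\<close> \<open>\<omega>2 > 0\<close> by (simp add: zero_less_mult_iff)
  define p where "p = nat k"
  have p: "p \<ge> 1" "\<omega>2 = real p * \<omega>1" using k \<open>k > 0\<close> by (auto simp: p_def)
  have "(l * m + M) / r0 ^ 3 = (real p)\<^sup>2 * ((real n * m + M) / r0 ^ 3)"
    using \<omega>1 \<omega>2 p(2) by (metis power_mult_distrib)
  then have "l * m + M = (real p)\<^sup>2 * (real n * m + M)"
    using \<open>r0 > 0\<close> by (simp add: field_simps)
  then have "l = real n * (real p)\<^sup>2 + M / m * ((real p)\<^sup>2 - 1)"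
    using \<open>m > 0\<close> by (simp add: field_simps)
  then show False using l[OF p(1)] by simp
qed

section \<open>Shooting for the periodic orbits\<close>

text \<open>
The shooting argument. The unknowns are \<open>\<alpha> \<in> {-1..1}\<close>, which fixes \<open>a\<^sup>2 = p0 + \<delta> \<alpha>\<close>, and
\<open>T \<in> {T0 - \<eta>..T0 + \<eta>}\<close>; the initial velocity \<open>\<delta>\<close> of \<open>f\<close> is a small parameter. The constants are
chosen in the order \<open>\<eta>\<close> (signs of the two sines), \<open>e\<close> (error that the signs tolerate), \<open>\<delta>\<close>.
\<close>

proposition periodic_orbit_near_circle:
  fixes n :: nat and m M r0 \<epsilon> :: real
  assumes n: "n \<ge> 2" and m: "m > 0" and M: "M \<ge> 0" and r0: "r0 > 0" and \<epsilon>: "\<epsilon> > 0"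
    and nonres: "\<And>p::nat. p \<ge> 1 \<Longrightarrow>
      lam n \<noteq> real n * (real p)\<^sup>2 + M / m * ((real p)\<^sup>2 - 1)"
  obtains a b T f r where "a > 0" "T > 0" "0 < b" "b < \<epsilon>"
    "\<bar>T - pi * sqrt (r0 ^ 3 / (real n * m + M))\<bar> < \<epsilon>"
    "\<bar>a - sqrt ((lam n * m + M) / r0)\<bar> < \<epsilon>"
    "odd_periodic_solution n m M r0 a b T f r"
proof -
  define s1 where "s1 = (real n * m + M) / r0 ^ 3"
  define s2 where "s2 = (lam n * m + M) / r0 ^ 3"
  define p0 where "p0 = (lam n * m + M) / r0"
  have lam: "lam n > 0" using n by (rule lam_pos)
  have pos: "real n * m + M > 0" "lam n * m + M > 0"
    using n m M lam by (auto intro!: add_pos_nonneg)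
  then have "s1 > 0" "s2 > 0" "p0 > 0" using r0 by (auto simp: s1_def s2_def p0_def)
  define \<omega>1 where "\<omega>1 = sqrt s1"
  define \<omega>2 where "\<omega>2 = sqrt s2"
  have \<omega>: "\<omega>1 > 0" "\<omega>2 > 0" "\<omega>1\<^sup>2 = s1" "\<omega>2\<^sup>2 = s2"
    using \<open>s1 > 0\<close> \<open>s2 > 0\<close> by (auto simp: \<omega>1_def \<omega>2_def)
  define T0 where "T0 = pi / \<omega>1"
  have "T0 > 0" using \<omega> by (simp add: T0_def)
  have T0_eq: "T0 = pi * sqrt (r0 ^ 3 / (real n * m + M))"
    by (simp add: T0_def \<omega>1_def s1_def real_sqrt_divide)
  have "sin (\<omega>2 * T0) \<noteq> 0"
    unfolding T0_def
    by (rule nonresonance[OF m r0 \<omega>(1,2) _ _ nonres]) (simp_all add: \<omega> s1_def s2_def)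
  \<comment> \<open>Multiplying by \<open>\<sigma>\<close> gives the limit of \<open>r' T / \<delta>\<close> the sign of \<open>\<alpha>\<close> for \<open>T\<close> near \<open>T0\<close>.\<close>
  define \<sigma> where "\<sigma> = sgn (sin (\<omega>2 * T0))"
  define q where "q = \<bar>sin (\<omega>2 * T0)\<bar> / 2"
  have "q > 0" and \<sigma>: "\<sigma> \<noteq> 0" "\<bar>\<sigma>\<bar> = 1" using \<open>sin (\<omega>2 * T0) \<noteq> 0\<close>
    by (auto simp: q_def \<sigma>_def sgn_if)
  have "isCont (\<lambda>T. sin (\<omega>2 * T)) T0" by (intro continuous_intros)
  then obtain \<eta>0 where "\<eta>0 > 0"
    and \<eta>0: "\<And>T. \<bar>T - T0\<bar> < \<eta>0 \<Longrightarrow> \<bar>sin (\<omega>2 * T) - sin (\<omega>2 * T0)\<bar> < q"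
    unfolding continuous_at_eps_delta using \<open>q > 0\<close> by (metis dist_real_def)
  define \<eta> where "\<eta> = min \<eta>0 (min \<epsilon> T0) / 2"
  have \<eta>: "\<eta> > 0" "\<eta> < \<eta>0" "\<eta> < \<epsilon>" "\<eta> < T0"
    using \<open>\<eta>0 > 0\<close> \<open>\<epsilon> > 0\<close> \<open>T0 > 0\<close> by (auto simp: \<eta>_def min_def)
  have sin2: "\<sigma> * sin (\<omega>2 * T) \<ge> q" if "T \<in> {T0 - \<eta>..T0 + \<eta>}" for T
  proof -
    have "\<bar>T - T0\<bar> < \<eta>0" using that \<eta> by auto
    from \<eta>0[OF this] show ?thesis
      by (auto simp: \<sigma>_def q_def sgn_if abs_if split: if_splits)
  qed
  have "0 < \<omega>1 * \<eta>" "\<omega>1 * \<eta> < pi"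
    using \<eta> \<omega> by (auto simp: T0_def less_divide_eq mult.commute)
  then have "sin (\<omega>1 * \<eta>) > 0" by (rule sin_gt_zero)
  have \<omega>T0: "\<omega>1 * T0 = pi" using \<omega> by (simp add: T0_def)
  have sin1: "sin (\<omega>1 * (T0 - \<eta>)) = sin (\<omega>1 * \<eta>)" "sin (\<omega>1 * (T0 + \<eta>)) = - sin (\<omega>1 * \<eta>)"
    by (simp_all add: distrib_left right_diff_distrib \<omega>T0 sin_diff sin_add)

  \<comment> \<open>The smaller of the lower bounds for the absolute values that the two limit functions have on
    the respective edges of the rectangle; an error of at most \<open>e\<close> keeps the signs.\<close>
  define e where "e = min (sin (\<omega>1 * \<eta>) / \<omega>1) (q / (r0 * \<omega>2))"
  have e: "e > 0" "e \<le> sin (\<omega>1 * \<eta>) / \<omega>1" "e \<le> q / (r0 * \<omega>2)"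
    using \<open>sin (\<omega>1 * \<eta>) > 0\<close> \<open>q > 0\<close> \<omega> r0 by (auto simp: e_def)
  define K where "K = 1 / \<omega>1 + (1 + (2 / (r0 * \<omega>2\<^sup>2) + (1 / (r0 * \<omega>2) + 1)))"
  have "K > 0" unfolding K_def using \<omega>(1,2) r0 by (intro add_pos_pos) auto
  let ?y = "linearized_orbit \<omega>1 \<omega>2 r0"

  \<comment> \<open>Any box with the equilibrium in its interior would do; this one contains the unit
    distance in \<open>f\<close> and \<open>p\<close> and the distance \<open>r0 / 2\<close> in \<open>r\<close> from the equilibrium.\<close>
  define \<rho> where "\<rho> = r0 / 2"
  define B where "B = 2 * r0 + p0 + 2"
  have \<rho>: "0 < \<rho>" "\<rho> < r0" "r0 < B" "\<bar>p0\<bar> < B" "B \<ge> 0"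
    using r0 \<open>p0 > 0\<close> by (auto simp: \<rho>_def B_def)
  define F where "F z = reduced_field n m M r0 (truncate \<rho> B z)" for z
  obtain L where L: "L-lipschitz_on UNIV F"
    unfolding F_def[abs_def] by (rule truncated_field_lipschitz[OF \<rho>(1)])
  have "\<exists>x. x 0 = z \<and> (\<forall>t. (x has_vector_derivative F (x t)) (at t))" for z
    by (rule lipschitz_ode_global_solution[OF L]) blast
  then obtain \<Phi> where \<Phi>0: "\<Phi> z 0 = z" and \<Phi>: "(\<Phi> z has_vector_derivative F (\<Phi> z t)) (at t)" for z t
    by metis
  let ?c = "(0, 0, r0, 0, p0) :: state"
  have trunc: "\<forall>\<^sub>F z in nhds ?c. truncate \<rho> B z = z"
    by (rule truncate_eventually_id[OF \<rho>(1-4)])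
  have "hdist n m M 0 r0 = r0" using r0 by (simp add: hdist_def)
  then have "reduced_field n m M r0 ?c = 0"
    using r0 by (simp add: reduced_field_def p0_def zero_prod_def field_simps eval_nat_numeral)
  moreover have "truncate \<rho> B ?c = ?c" using eventually_nhds_x_imp_x[OF trunc] .
  ultimately have "F ?c = 0" by (simp add: F_def)
  have "(F has_derivative linearized_field s1 s2 r0) (at ?c)"
  proof -
    have "\<forall>\<^sub>F z in nhds ?c. reduced_field n m M r0 z = F z"
      using trunc by eventually_elim (simp add: F_def)
    then have "\<forall>\<^sub>F z in at ?c. reduced_field n m M r0 z = F z"
      by (simp add: eventually_at_filter eventually_mono)
    from has_derivative_transform_eventually[OF
        reduced_field_has_derivative_at_equilibrium[OF r0 p0_def] this]
    show ?thesis
      using \<open>truncate \<rho> B ?c = ?c\<close> unfolding s1_def s2_def F_def by simp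
  qed
  then have dF: "(F has_derivative linearized_field (\<omega>1\<^sup>2) (\<omega>2\<^sup>2) r0) (at ?c)"
    by (simp add: \<omega>)
  have "T0 + \<eta> \<ge> 0" using \<open>T0 > 0\<close> \<eta> by simp
  obtain d where "d > 0"
    and d: "\<And>\<delta> x y t. \<lbrakk>0 < \<delta>; \<delta> < d;
        \<And>t. t \<in> {0..T0 + \<eta>} \<Longrightarrow> (x has_vector_derivative F (x t)) (at t);
        \<And>t. t \<in> {0..T0 + \<eta>} \<Longrightarrow>
          (y has_vector_derivative linearized_field (\<omega>1\<^sup>2) (\<omega>2\<^sup>2) r0 (y t)) (at t);
        \<And>t. t \<in> {0..T0 + \<eta>} \<Longrightarrow> norm (y t) \<le> K;
        x 0 = ?c + \<delta> *\<^sub>R y 0; t \<in> {0..T0 + \<eta>}\<rbrakk>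
      \<Longrightarrow> norm (x t - (?c + \<delta> *\<^sub>R y t)) \<le> \<delta> * e"
    by (rule flow_linearization_at_equilibrium[OF L \<open>F ?c = 0\<close> dF \<open>T0 + \<eta> \<ge> 0\<close> \<open>K > 0\<close> \<open>e > 0\<close>])
      blast
  have "isCont sqrt p0" by (intro continuous_intros)
  then obtain d' where "d' > 0" and d': "\<And>p. \<bar>p - p0\<bar> < d' \<Longrightarrow> \<bar>sqrt p - sqrt p0\<bar> < \<epsilon>"
    unfolding continuous_at_eps_delta using \<open>\<epsilon> > 0\<close> by (metis dist_real_def)
  \<comment> \<open>Below \<open>g\<close>, the orbit stays in the box, since its distance from the equilibrium is at most
    \<open>\<delta> (K + e)\<close>.\<close>
  define g where "g = min \<rho> 1 / (K + e)"
  define \<delta> where "\<delta> = min (min d d') (min (min \<epsilon> p0) g) / 2"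
  have "g > 0" using \<rho> \<open>K > 0\<close> e by (simp add: g_def)
  then have \<delta>: "\<delta> > 0" "\<delta> < d" "\<delta> < d'" "\<delta> < \<epsilon>" "\<delta> < p0" "\<delta> < g"
    unfolding \<delta>_def using \<open>d > 0\<close> \<open>d' > 0\<close> \<open>\<epsilon> > 0\<close> \<open>p0 > 0\<close> by (auto simp: min_def)
  have \<delta>_small: "\<delta> * (K + e) < \<rho>" "\<delta> * (K + e) < 1"
    using \<delta>(6) \<open>K > 0\<close> e by (auto simp: g_def less_divide_eq)

  define X where "X \<alpha> = \<Phi> (0, \<delta>, r0, 0, p0 + \<delta> * \<alpha>)" for \<alpha>
  have X: "(X \<alpha> has_vector_derivative F (X \<alpha> t)) (at t)" for \<alpha> t
    unfolding X_def by (rule \<Phi>)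
  have approx: "norm (X \<alpha> t - (?c + \<delta> *\<^sub>R ?y \<alpha> t)) \<le> \<delta> * e"
    if "\<alpha> \<in> {-1..1}" "t \<in> {0..T0 + \<eta>}" for \<alpha> t
  proof (rule d[OF \<delta>(1,2) X linearized_orbit_solves[OF \<omega>(1,2) r0] _ _ that(2)])
    show "norm (?y \<alpha> t) \<le> K" for t
      unfolding K_def using that by (intro linearized_orbit_bounded \<omega> r0) auto
    show "X \<alpha> 0 = ?c + \<delta> *\<^sub>R ?y \<alpha> 0"
      by (simp add: X_def \<Phi>0 linearized_orbit_0)
  qed
  have near: "norm (X \<alpha> t - ?c) \<le> \<delta> * (K + e)"
    if "\<alpha> \<in> {-1..1}" "t \<in> {0..T0 + \<eta>}" for \<alpha> t
  proof -
    have "norm (X \<alpha> t - ?c) \<le> norm (\<delta> *\<^sub>R ?y \<alpha> t) + norm (X \<alpha> t - (?c + \<delta> *\<^sub>R ?y \<alpha> t))"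
      using norm_triangle_sub[of "X \<alpha> t - ?c" "\<delta> *\<^sub>R ?y \<alpha> t"] by (simp only: diff_diff_eq)
    moreover have "norm (?y \<alpha> t) \<le> K"
      unfolding K_def using that by (intro linearized_orbit_bounded \<omega> r0) auto
    then have "norm (\<delta> *\<^sub>R ?y \<alpha> t) \<le> \<delta> * K" using \<delta>(1) by simp
    ultimately show ?thesis using approx[OF that] unfolding distrib_left by linarith
  qed
  have arc: "\<bar>fst (X \<alpha> t)\<bar> \<le> B \<and> \<rho> \<le> fst (snd (snd (X \<alpha> t))) \<and>
      fst (snd (snd (X \<alpha> t))) \<le> B \<and> \<bar>snd (snd (snd (snd (X \<alpha> t))))\<bar> \<le> B"
    if "\<alpha> \<in> {-1..1}" "t \<in> {0..T0 + \<eta>}" for \<alpha> t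
    using near[OF that] abs_components_le_norm[of "X \<alpha> t - ?c"] \<delta>_small r0 \<open>p0 > 0\<close>
    by (simp add: \<rho>_def B_def abs_le_iff)

  have approx_f: "\<bar>fst (X \<alpha> t) - \<delta> * (sin (\<omega>1 * t) / \<omega>1)\<bar> \<le> \<delta> * e"
    and approx_w: "\<bar>fst (snd (snd (snd (X \<alpha> t)))) - \<delta> * (\<alpha> / (r0 * \<omega>2) * sin (\<omega>2 * t))\<bar> \<le> \<delta> * e"
    if "\<alpha> \<in> {-1..1}" "t \<in> {T0 - \<eta>..T0 + \<eta>}" for \<alpha> t
    using approx[OF that(1), of t] that(2) \<eta>
      abs_components_le_norm(1,3)[of "X \<alpha> t - (?c + \<delta> *\<^sub>R ?y \<alpha> t)"]
    by (auto simp: linearized_orbit_def)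

  have contX: "continuous_on ({-1..1} \<times> {T0 - \<eta>..T0 + \<eta>}) (\<lambda>z. X (fst z) (snd z))"
  proof -
    have "continuous_on ({-1..1} \<times> {T0 - \<eta>..T0 + \<eta>})
        (\<lambda>z. case ((0, \<delta>, r0, 0, p0 + \<delta> * fst z), snd z) of (p, t) \<Rightarrow> \<Phi> p t)"
      by (rule continuous_on_compose2[OF lipschitz_flow_jointly_continuous[OF L \<Phi>0 \<Phi>]])
        (use \<eta> in \<open>auto intro!: continuous_intros\<close>)
    then show ?thesis by (simp add: X_def)
  qed
  \<comment> \<open>The sign of \<open>f T\<close> is reversed because \<open>sin (\<omega>1 T)\<close> decreases through its zero \<open>T0\<close>.\<close>
  have "\<exists>\<alpha>\<in>{-1..1}. \<exists>T\<in>{T0 - \<eta>..T0 + \<eta>}.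
      \<sigma> * fst (snd (snd (snd (X \<alpha> T)))) = 0 \<and> - fst (X \<alpha> T) = 0" (is ?zero)
  proof (rule poincare_miranda_rectangle[of "-1" 1 "T0 - \<eta>" "T0 + \<eta>"
        "\<lambda>z. \<sigma> * fst (snd (snd (snd (X (fst z) (snd z)))))" "\<lambda>z. - fst (X (fst z) (snd z))"])
    fix T assume T: "T \<in> {T0 - \<eta>..T0 + \<eta>}"
    have "e \<le> \<sigma> * sin (\<omega>2 * T) / (r0 * \<omega>2)"
      using e(3) sin2[OF T] \<omega> r0 by (meson divide_right_mono less_imp_le mult_pos_pos order_trans)
    then have dom: "\<delta> * e \<le> \<delta> * (\<sigma> * sin (\<omega>2 * T) / (r0 * \<omega>2))"
      using \<delta>(1) by (intro mult_left_mono) auto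
    have "\<bar>\<sigma> * fst (snd (snd (snd (X \<alpha> T)))) - \<alpha> * (\<delta> * (\<sigma> * sin (\<omega>2 * T) / (r0 * \<omega>2)))\<bar> \<le> \<delta> * e"
      if "\<alpha> \<in> {-1..1}" for \<alpha>
    proof -
      have "\<sigma> * fst (snd (snd (snd (X \<alpha> T)))) - \<alpha> * (\<delta> * (\<sigma> * sin (\<omega>2 * T) / (r0 * \<omega>2))) =
          \<sigma> * (fst (snd (snd (snd (X \<alpha> T)))) - \<delta> * (\<alpha> / (r0 * \<omega>2) * sin (\<omega>2 * T)))"
        by (simp add: algebra_simps)
      then show ?thesis using approx_w[OF that T] \<sigma> by (simp only: abs_mult) simp
    qed
    from this[of "-1"] this[of 1] dom
    show "\<sigma> * fst (snd (snd (snd (X (fst (- 1, T)) (snd (- 1, T)))))) \<le> 0"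
      and "0 \<le> \<sigma> * fst (snd (snd (snd (X (fst (1, T)) (snd (1, T))))))"
      by (auto simp: abs_le_iff)
  next
    fix \<alpha> :: real assume \<alpha>: "\<alpha> \<in> {-1..1}"
    have dom: "\<delta> * e \<le> \<delta> * (sin (\<omega>1 * \<eta>) / \<omega>1)"
      using \<delta>(1) e(2) by (intro mult_left_mono) auto
    show "- fst (X (fst (\<alpha>, T0 - \<eta>)) (snd (\<alpha>, T0 - \<eta>))) \<le> 0"
      using approx_f[OF \<alpha>, of "T0 - \<eta>"] dom \<eta> by (auto simp: sin1 abs_le_iff)
    show "0 \<le> - fst (X (fst (\<alpha>, T0 + \<eta>)) (snd (\<alpha>, T0 + \<eta>)))"
      using approx_f[OF \<alpha>, of "T0 + \<eta>"] dom \<eta> by (auto simp: sin1 abs_le_iff)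
  next
    fix \<alpha> T
    assume "\<alpha> \<in> {-1..1}" "T \<in> {T0 - \<eta>..T0 + \<eta>}"
      "\<sigma> * fst (snd (snd (snd (X (fst (\<alpha>, T)) (snd (\<alpha>, T)))))) = 0"
      "- fst (X (fst (\<alpha>, T)) (snd (\<alpha>, T))) = 0"
    then show ?zero by (intro bexI[of _ \<alpha>] bexI[of _ T]) simp_all
  qed (use \<eta> in \<open>auto intro!: continuous_intros contX\<close>)
  then obtain \<alpha> T where \<alpha>: "\<alpha> \<in> {-1..1}" and T: "T \<in> {T0 - \<eta>..T0 + \<eta>}"
    and zero: "fst (X \<alpha> T) = 0" "fst (snd (snd (snd (X \<alpha> T)))) = 0"
    using \<sigma> by auto
  define a where "a = sqrt (p0 + \<delta> * \<alpha>)"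
  have "\<bar>\<delta> * \<alpha>\<bar> \<le> \<delta> * 1"
    unfolding abs_mult using \<alpha> \<delta>(1) by (intro mult_mono) auto
  then have \<delta>\<alpha>: "\<bar>\<delta> * \<alpha>\<bar> \<le> \<delta>" by simp
  then have pa: "p0 + \<delta> * \<alpha> > 0" using \<delta>(5) by (auto simp: abs_le_iff)
  then have a: "a > 0" "a\<^sup>2 = p0 + \<delta> * \<alpha>" by (simp_all add: a_def)
  show thesis
  proof (rule that[of a T \<delta> "\<lambda>t. fst (X \<alpha> t)" "\<lambda>t. fst (snd (snd (X \<alpha> t)))"])
    show "T > 0" using T \<eta> by auto
    show "\<bar>T - pi * sqrt (r0 ^ 3 / (real n * m + M))\<bar> < \<epsilon>"
      using T \<eta> unfolding T0_eq by auto
    show "\<bar>a - sqrt ((lam n * m + M) / r0)\<bar> < \<epsilon>"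
      using d'[of "p0 + \<delta> * \<alpha>"] \<delta>\<alpha> \<delta>(3) by (simp add: a_def p0_def)
    show "odd_periodic_solution n m M r0 a \<delta> T (\<lambda>t. fst (X \<alpha> t)) (\<lambda>t. fst (snd (snd (X \<alpha> t))))"
    proof (rule reversible_arc_gives_periodic_solution[where X = "X \<alpha>", OF \<rho>(1) \<rho>(5) \<open>T > 0\<close> _ _ zero])
      show "(X \<alpha> has_vector_derivative reduced_field n m M r0 (truncate \<rho> B (X \<alpha> t))) (at t)" for t
        using X[of \<alpha> t] by (simp add: F_def)
      show "X \<alpha> 0 = (0, \<delta>, r0, 0, a\<^sup>2)" by (simp add: X_def \<Phi>0 a)
    qed (use arc[OF \<alpha>] T in auto)
  qed (use a \<delta> in auto)
qed

theorem theorem3p1: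
  fixes n :: nat and m M :: real
  assumes "n \<ge> 2" and "m > 0" and "M \<ge> 0"
    and "\<And>p::nat. p \<ge> 1 \<Longrightarrow>
      lam n \<noteq> real n * (real p)\<^sup>2 + M / m * ((real p)\<^sup>2 - 1)"
  shows "\<forall>r0::real. r0 > 0 \<longrightarrow> (\<forall>\<epsilon>::real. \<epsilon> > 0 \<longrightarrow>
    (\<exists>a b T :: real. a > 0 \<and> T > 0 \<and> 0 < \<bar>b\<bar> \<and> \<bar>b\<bar> < \<epsilon> \<and>
      \<bar>T - pi * sqrt (r0 ^ 3 / (real n * m + M))\<bar> < \<epsilon> \<and>
      \<bar>a - sqrt ((lam n * m + M) / r0)\<bar> < \<epsilon> \<and>
      (\<exists>f r. reduced_ivp_solution n m M r0 a b f r) \<and>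
      (\<forall>f r. reduced_ivp_solution n m M r0 a b f r \<longrightarrow>
        odd_periodic_solution n m M r0 a b T f r)))"
proof (intro allI impI)
  fix r0 \<epsilon> :: real assume "r0 > 0" "\<epsilon> > 0"
  then obtain a b T f r where ab: "a > 0" "T > 0" "0 < b" "b < \<epsilon>"
    "\<bar>T - pi * sqrt (r0 ^ 3 / (real n * m + M))\<bar> < \<epsilon>"
    "\<bar>a - sqrt ((lam n * m + M) / r0)\<bar> < \<epsilon>"
    and per: "odd_periodic_solution n m M r0 a b T f r"
    using periodic_orbit_near_circle[OF assms(1-3) _ _ assms(4)] by metis
  then have ivp: "reduced_ivp_solution n m M r0 a b f r"
    by (simp add: odd_periodic_solution_def)
  have "odd_periodic_solution n m M r0 a b T f' r'"
    if "reduced_ivp_solution n m M r0 a b f' r'" for f' r'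
  proof -
    have "f' = f" "r' = r" using reduced_ivp_solution_unique[OF that ivp] by auto
    then show ?thesis using per by simp
  qed
  with ab ivp show "\<exists>a b T :: real. a > 0 \<and> T > 0 \<and> 0 < \<bar>b\<bar> \<and> \<bar>b\<bar> < \<epsilon> \<and>
      \<bar>T - pi * sqrt (r0 ^ 3 / (real n * m + M))\<bar> < \<epsilon> \<and>
      \<bar>a - sqrt ((lam n * m + M) / r0)\<bar> < \<epsilon> \<and>
      (\<exists>f r. reduced_ivp_solution n m M r0 a b f r) \<and>
      (\<forall>f r. reduced_ivp_solution n m M r0 a b f r \<longrightarrow>
        odd_periodic_solution n m M r0 a b T f r)"
    by (intro exI[of _ a] exI[of _ b] exI[of _ T]) auto
qed

end
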